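(* Let $P_d\in\mathcal{O}$ be a monic irreducible polynomial of degree $d$ and let $k\geqslant 0$ and $m$ be integers. Consider the operator $\mathbf{U}_{P_d}$ acting on $S^1_{k,m}(\Gamma_0(P_d))$ and the degeneracy map $\delta_{P_d}:S^1_{k,m}(GL_2(\mathcal{O}))\to S^1_{k,m}(\Gamma_0(P_d))$. Then $$Ker(\mathbf{U}_{P_d})=Im(\delta_{P_d}).$$
   Context: Let $q$ be a power of a prime $p$, $K=\mathbb{F}_q(t)$, $\mathcal{O}=\mathbb{F}_q[t]$, $K_\infty=\mathbb{F}_q((1/t))$ the completion of $K$ at the place $1/t$, and $\mathbb{C}_\infty$ the completion of an algebraic closure of $K_\infty$. Let $\Omega=\mathbb{P}^1(\mathbb{C}_\infty)-\mathbb{P}^1(K_\infty)$ be the Drinfeld upper half-plane with its rigid analytic structure; $GL_2(K_\infty)$ acts on it by Möbius transformations. For $\gamma=\begin{pmatrix}a&b\\c&d\end{pmatrix}\in GL_2(K_\infty)$, integers $k,m$, and $\varphi:\Omega\to\mathbb{C}_\infty$, put $$(\varphi|_{k,m}\gamma)(z)=\varphi(\gamma z)(\det\gamma)^m(cz+d)^{-k}.$$ Let $\Gamma_0(P_d)=\{\begin{pmatrix}a&b\\c&d\end{pmatrix}\in GL_2(\mathcal{O}): c\equiv 0 \pmod{P_d}\}$. For $\Gamma\in\{GL_2(\mathcal{O}),\Gamma_0(P_d)\}$, the $\mathbb{C}_\infty$-vector space $S^1_{k,m}(\Gamma)$ of cusp forms of weight $k\geqslant 0$ and type $m$ (which matters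 only modulo $q-1$) for $\Gamma$ consists of the rigid analytic functions $\varphi:\Omega\to\mathbb{C}_\infty$ with $\varphi|_{k,m}\gamma=\varphi$ for all $\gamma\in\Gamma$ that are holomorphic at all cusps of $\Gamma$ and vanish at all cusps (in the usual sense for Drinfeld modular forms; the cusps are the $\Gamma$-equivalence classes in $\mathbb{P}^1(K)$). An integer representative $m$ of the type is fixed in the formulas below. The Atkin operator on $S^1_{k,m}(\Gamma_0(P_d))$ is $$\mathbf{U}_{P_d}(\varphi)=P_d^{k-m}\sum_{Q\in\mathcal{O},\ \deg Q<d}\varphi|_{k,m}\begin{pmatrix}1&Q\\0&P_d\end{pmatrix}$$ (the sum includes $Q=0$). The degeneracy map $\delta_{P_d}:S^1_{k,m}(GL_2(\mathcal{O}))\to S^1_{k,m}(\Gamma_0(P_d))$ is $\delta_{P_d}\varphi=\varphi|_{k,m}\begin{pmatrix}P_d&0\\0&1\end{pmatrix}$, i.e. $(\delta_{P_d}\varphi)(z)=P_d^m\varphi(P_dz)$. *)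

theory Defs
  imports "HOL-Analysis.Analysis" "HOL-Computational_Algebra.Formal_Laurent_Series"
begin

text \<open>
  The finite field \<open>\<F>\<^sub>q\<close> is an arbitrary type \<open>'a\<close> of sort \<open>{finite, field}\<close>, so that
  \<open>q = CARD('a)\<close>, and \<open>\<O> = \<F>\<^sub>q[t]\<close> is the type \<open>'a poly\<close>. The field \<open>K\<^sub>\<infinity> = \<F>\<^sub>q((1/t))\<close> is the type
  \<open>'a fls\<close> of formal Laurent series in the variable \<open>X = 1/t\<close>; thus \<open>t\<close> is \<^const>\<open>fls_X_inv\<close>.
\<close>

definition poly_fls :: "'a::field poly \<Rightarrow> 'a fls" where
  "poly_fls p = poly (map_poly fls_const p) fls_X_inv"

text \<open>
  \<open>\<C>\<^sub>\<infinity>\<close> is a field \<open>'c\<close> with a complete metric together with an embedding \<open>\<iota>\<close> of \<open>K\<^sub>\<infinity>\<close>. The metric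
  comes from a non-archimedean absolute value (\<open>\<bar>x\<bar> = dist x 0\<close>) extending that of \<open>K\<^sub>\<infinity>\<close>,
  normalised by \<open>\<bar>t\<bar> = q\<close>, and the elements algebraic over \<open>K\<^sub>\<infinity>\<close> form an algebraically closed
  (hence an algebraic closure of \<open>K\<^sub>\<infinity>\<close>), dense subset. This determines \<open>\<C>\<^sub>\<infinity>\<close> up to an isometric
  isomorphism over \<open>K\<^sub>\<infinity>\<close>.
\<close>

definition algebraic_over :: "('b::field \<Rightarrow> 'c::field) \<Rightarrow> 'c set" where
  "algebraic_over \<iota> = {x. \<exists>p :: 'b poly. p \<noteq> 0 \<and> poly (map_poly \<iota> p) x = 0}"

locale C_infinity =
  fixes \<iota> :: "'a::{finite,field} fls \<Rightarrow> 'c::{field,complete_space}"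
  assumes hom_one: "\<iota> 1 = 1"
    and hom_add: "\<iota> (f + g) = \<iota> f + \<iota> g"
    and hom_mult: "\<iota> (f * g) = \<iota> f * \<iota> g"
    and dist_diff: "dist (x::'c) y = dist (x - y) 0"
    and abs_mult: "dist ((x::'c) * y) 0 = dist x 0 * dist y 0"
    and ultrametric: "dist ((x::'c) + y) 0 \<le> max (dist x 0) (dist y 0)"
    and abs_extends: "f \<noteq> 0 \<Longrightarrow> dist (\<iota> f) 0 = real CARD('a) powi (- fls_subdegree f)"
    and alg_closed: "set (coeffs p) \<subseteq> algebraic_over \<iota> \<Longrightarrow> degree p > 0 \<Longrightarrow>
          \<exists>x\<in>algebraic_over \<iota>. poly p x = 0"
    and dense: "closure (algebraic_over \<iota>) = UNIV"

abbreviation cpoly :: "('a::field fls \<Rightarrow> 'c) \<Rightarrow> 'a poly \<Rightarrow> 'c" where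
  "cpoly \<iota> p \<equiv> \<iota> (poly_fls p)"

text \<open>
  Since \<open>\<infinity>\<close> lies in \<open>P\<^sup>1(K\<^sub>\<infinity>)\<close>, the Drinfeld upper half-plane is \<open>\<C>\<^sub>\<infinity> - K\<^sub>\<infinity>\<close>. Functions
  \<open>\<Omega> \<rightarrow> \<C>\<^sub>\<infinity>\<close> are represented by functions on \<open>\<C>\<^sub>\<infinity>\<close> that vanish outside \<open>\<Omega>\<close>.
\<close>

definition Omega :: "('a::field fls \<Rightarrow> 'c) \<Rightarrow> 'c set" where
  "Omega \<iota> = - range \<iota>"

text \<open>
  The affinoids \<open>\<Omega>\<^sub>n = {\<bar>z\<bar> \<le> q\<^sup>n, \<bar>z - x\<bar> \<ge> q\<^sup>-\<^sup>n for all x \<in> K\<^sub>\<infinity>}\<close> form the usual admissible covering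
  of \<open>\<Omega>\<close>. A function is analytic on such an affinoid subset of \<open>P\<^sup>1\<close> if it is a uniform limit of
  rational functions without poles there.
\<close>

definition Omega_affinoid ::
    "('a::{finite,field} fls \<Rightarrow> 'c::{field,metric_space}) \<Rightarrow> nat \<Rightarrow> 'c set" where
  "Omega_affinoid \<iota> n = {z. dist z 0 \<le> real CARD('a) ^ n \<and>
     (\<forall>x. dist z (\<iota> x) \<ge> 1 / real CARD('a) ^ n)}"

definition rigid_analytic ::
    "('a::{finite,field} fls \<Rightarrow> 'c::{field,metric_space}) \<Rightarrow> ('c \<Rightarrow> 'c) \<Rightarrow> bool" where
  "rigid_analytic \<iota> f \<longleftrightarrow> (\<forall>z. z \<notin> Omega \<iota> \<longrightarrow> f z = 0) \<and>
     (\<forall>n. \<forall>\<epsilon>>0. \<exists>g h :: 'c poly. \<forall>z\<in>Omega_affinoid \<iota> n.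
        poly h z \<noteq> 0 \<and> dist (f z) (poly g z / poly h z) < \<epsilon>)"

text \<open>
  For \<open>\<gamma> \<in> GL\<^sub>2(K\<^sub>\<infinity>)\<close>. An element \<open>z\<close> of \<open>\<Omega>\<close> is never a pole of \<open>\<gamma>\<close>, as \<open>cz + d \<noteq> 0\<close>.
\<close>

definition moebius :: "('a::field fls \<Rightarrow> 'c::field) \<Rightarrow> 'a fls^2^2 \<Rightarrow> 'c \<Rightarrow> 'c" where
  "moebius \<iota> \<gamma> z = (\<iota> (\<gamma>$1$1) * z + \<iota> (\<gamma>$1$2)) / (\<iota> (\<gamma>$2$1) * z + \<iota> (\<gamma>$2$2))"

definition slash ::
    "('a::field fls \<Rightarrow> 'c::field) \<Rightarrow> int \<Rightarrow> int \<Rightarrow> ('c \<Rightarrow> 'c) \<Rightarrow> 'a fls^2^2 \<Rightarrow> 'c \<Rightarrow> 'c" where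
  "slash \<iota> k m \<phi> \<gamma> = (\<lambda>z. if z \<in> Omega \<iota>
     then \<phi> (moebius \<iota> \<gamma> z) * \<iota> (det \<gamma>) powi m * (\<iota> (\<gamma>$2$1) * z + \<iota> (\<gamma>$2$2)) powi (- k)
     else 0)"

abbreviation pslash ::
    "('a::field fls \<Rightarrow> 'c::field) \<Rightarrow> int \<Rightarrow> int \<Rightarrow> ('c \<Rightarrow> 'c) \<Rightarrow> 'a poly^2^2 \<Rightarrow> 'c \<Rightarrow> 'c" where
  "pslash \<iota> k m \<phi> \<gamma> \<equiv> slash \<iota> k m \<phi> (map_matrix poly_fls \<gamma>)"

abbreviation mat2 :: "'b \<Rightarrow> 'b \<Rightarrow> 'b \<Rightarrow> 'b \<Rightarrow> 'b::zero^2^2" where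
  "mat2 a b c d \<equiv> vector [vector [a, b], vector [c, d]]"

definition GL2 :: "('a::field poly^2^2) set" where
  "GL2 = {\<gamma>. invertible \<gamma>}"

definition Gamma0 :: "'a::field poly \<Rightarrow> ('a poly^2^2) set" where
  "Gamma0 P = {\<gamma> \<in> GL2. P dvd \<gamma>$2$1}"

text \<open>
  The lattice of those \<open>b\<close> for which the translation \<open>z \<mapsto> z + b\<close> belongs to \<open>\<gamma>\<^sup>-\<^sup>1 \<Gamma> \<gamma>\<close>.
\<close>

definition translation_lattice :: "('a::field poly^2^2) set \<Rightarrow> 'a poly^2^2 \<Rightarrow> 'a poly set" where
  "translation_lattice \<Gamma> \<gamma> = {b. \<exists>g\<in>\<Gamma>. \<gamma> ** mat2 1 b 0 1 = g ** \<gamma>}"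

text \<open>
  The Carlitz--Drinfeld exponential \<open>e\<^sub>\<Lambda>(z) = z \<Prod> (1 - z/l)\<close>, the product being taken over the
  nonzero \<open>l \<in> \<Lambda>\<close>, and the parameter \<open>u\<^sub>\<Lambda> = 1/e\<^sub>\<Lambda>\<close> at infinity. The customary rescaling
  of the parameter by a period in \<open>\<C>\<^sub>\<infinity>\<close> affects neither holomorphy nor vanishing.
\<close>

definition exp_lattice ::
    "('a::field fls \<Rightarrow> 'c::{field,metric_space}) \<Rightarrow> 'a poly set \<Rightarrow> 'c \<Rightarrow> 'c" where
  "exp_lattice \<iota> \<Lambda> z =
     z * Lim (finite_subsets_at_top (\<Lambda> - {0})) (\<lambda>F. \<Prod>l\<in>F. 1 - z / cpoly \<iota> l)"

definition cusp_param ::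
    "('a::field fls \<Rightarrow> 'c::{field,metric_space}) \<Rightarrow> 'a poly set \<Rightarrow> 'c \<Rightarrow> 'c" where
  "cusp_param \<iota> \<Lambda> z = 1 / exp_lattice \<iota> \<Lambda> z"

text \<open>
  \<open>f(z) = \<Sum>\<^sub>n a\<^sub>n u\<^sub>\<Lambda>(z)\<^sup>n\<close> in a neighbourhood of infinity, i.e. for \<open>\<bar>u\<^sub>\<Lambda>(z)\<bar>\<close> small. As only \<open>n \<ge> 0\<close>
  occurs, this is holomorphy at infinity; \<open>a\<^sub>0 = 0\<close> means vanishing there.
\<close>

definition has_cusp_expansion ::
    "('a::field fls \<Rightarrow> 'c::{field,metric_space}) \<Rightarrow> 'a poly set \<Rightarrow> ('c \<Rightarrow> 'c) \<Rightarrow> (nat \<Rightarrow> 'c) \<Rightarrow> bool"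
  where "has_cusp_expansion \<iota> \<Lambda> f a \<longleftrightarrow>
     (\<exists>r>0. \<forall>z\<in>Omega \<iota>. dist (cusp_param \<iota> \<Lambda> z) 0 < r \<longrightarrow>
        (\<lambda>n. a n * cusp_param \<iota> \<Lambda> z ^ n) sums f z)"

text \<open>
  Every cusp, i.e. every element of \<open>P\<^sup>1(K)\<close>, is of the form \<open>\<gamma>\<infinity>\<close> with \<open>\<gamma> \<in> GL\<^sub>2(\<O>)\<close>, because \<open>\<O>\<close>
  is a principal ideal domain. The behaviour of \<open>\<phi>\<close> at \<open>\<gamma>\<infinity>\<close> is that of \<open>\<phi>|\<gamma>\<close> at \<open>\<infinity>\<close>.
\<close>

definition cusp_forms ::
    "('a::{finite,field} fls \<Rightarrow> 'c::{field,metric_space}) \<Rightarrow> ('a poly^2^2) set \<Rightarrow> int \<Rightarrow> int \<Rightarrow>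
     ('c \<Rightarrow> 'c) set" where
  "cusp_forms \<iota> \<Gamma> k m = {\<phi>. rigid_analytic \<iota> \<phi> \<and>
     (\<forall>\<gamma>\<in>\<Gamma>. pslash \<iota> k m \<phi> \<gamma> = \<phi>) \<and>
     (\<forall>\<gamma>\<in>GL2. \<exists>a. has_cusp_expansion \<iota> (translation_lattice \<Gamma> \<gamma>) (pslash \<iota> k m \<phi> \<gamma>) a \<and> a 0 = 0)}"

text \<open>In the sum, \<open>degree P > 0\<close> is intended, so that \<open>Q = 0\<close> (of degree \<open>0\<close> here) is included.\<close>

definition Atkin_U ::
    "('a::field fls \<Rightarrow> 'c::field) \<Rightarrow> int \<Rightarrow> int \<Rightarrow> 'a poly \<Rightarrow> ('c \<Rightarrow> 'c) \<Rightarrow> 'c \<Rightarrow> 'c" where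
  "Atkin_U \<iota> k m P \<phi> = (\<lambda>z. cpoly \<iota> P powi (k - m) *
     (\<Sum>Q | degree Q < degree P. pslash \<iota> k m \<phi> (mat2 1 Q 0 P) z))"

definition degeneracy ::
    "('a::field fls \<Rightarrow> 'c::field) \<Rightarrow> int \<Rightarrow> int \<Rightarrow> 'a poly \<Rightarrow> ('c \<Rightarrow> 'c) \<Rightarrow> 'c \<Rightarrow> 'c" where
  "degeneracy \<iota> k m P \<phi> = pslash \<iota> k m \<phi> (mat2 P 0 0 1)"

end

theory Submission
  imports Defs "HOL-Computational_Algebra.Polynomial_Factorial"
begin

text \<open>
  Write \<open>S = (0, -1; 1, 0)\<close>, \<open>T\<^sub>Q = (1, Q; 0, 1)\<close> and \<open>A = (P, 0; 0, 1)\<close>, so that \<open>\<delta> \<psi> = \<psi>|A\<close>, and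
  \<open>U \<phi>\<close> is a nonzero multiple of \<open>\<Sum>\<^sub>Q \<phi>|(1, Q; 0, P)\<close>.

  The image of \<open>\<delta>\<close> lies in the kernel of \<open>U\<close> because \<open>A (1, Q; 0, P) = T\<^sub>Q (P, 0; 0, P)\<close>: by
  invariance under \<open>T\<^sub>Q\<close> all terms of \<open>U(\<delta> \<psi>)\<close> are equal, and the number of terms, a power of \<open>q\<close>,
  vanishes in \<open>\<C>\<^sub>\<infinity>\<close>.

  For the converse let \<open>U \<phi> = 0\<close> and put \<open>\<theta> = \<phi>|W\<close> with the Fricke-type matrix \<open>W = (0, 1; -P, 0)\<close>,
  which normalises \<open>\<Gamma>\<^sub>0(P)\<close>. The matrices \<open>1\<close> and \<open>S T\<^sub>Q\<close>, \<open>deg Q < deg P\<close>, represent the cosets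
  \<open>\<Gamma>\<^sub>0(P) \ GL\<^sub>2(\<O>)\<close>, and \<open>W S T\<^sub>Q = (1, Q; 0, P)\<close>. Hence the trace of \<open>\<theta>\<close> to \<open>GL\<^sub>2(\<O>)\<close> is
  \<open>\<theta> + \<Sum>\<^sub>Q \<phi>|(1, Q; 0, P) = \<theta>\<close>, so \<open>\<theta>\<close> is itself invariant under \<open>GL\<^sub>2(\<O>)\<close>
  (\<open>GL2_invariant_if_trace_vanishes\<close>). From \<open>\<theta> = \<theta>|S = \<phi>|(1, 0; 0, P)\<close> one gets
  \<open>\<theta>|A = \<phi>|(P, 0; 0, P)\<close>, which is a multiple of \<open>\<phi>\<close>, and so \<open>\<phi>\<close> is a multiple of \<open>\<delta> \<theta>\<close>.

  The other half of the work is analytic: the functions produced above must again be rigid analytic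
  and vanish at the cusps. Rigid analyticity survives the scalings \<open>z \<mapsto> x z\<close> with \<open>x \<in> K\<^sub>\<infinity>\<close>, as these
  map each affinoid of the covering into another one. At a cusp of \<open>\<Gamma>\<^sub>0(P)\<close> the translation lattice is
  either \<open>\<O>\<close> or \<open>P\<O>\<close>, so it suffices to compare the parameters of these two lattices before and after
  a substitution. With \<open>e = e\<^sub>\<O>\<close> and \<open>u = 1/e\<close>, everything follows from three properties of the
  exponential: \<open>e\<^sub>P\<^sub>\<O>(P z) = P e(z)\<close>, the additivity of \<open>e\<close>, and
  \<open>e(P z) = \<kappa> \<Prod>\<^sub>Q (e(z) - e(Q/P))\<close> with a constant \<open>\<kappa> \<noteq> 0\<close>. They show that the new parameter is, up to a
  constant, a finite product of functions \<open>u / (1 - w u)\<close> of the old one, and convergent power series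
  without constant term are stable under such substitutions (\<open>power_series_substitution\<close>).
\<close>

section \<open>Polynomials as Laurent series in $1/t$\<close>

lemma poly_fls_0 [simp]: "poly_fls 0 = 0"
  by (simp add: poly_fls_def)

lemma poly_fls_pCons: "poly_fls (pCons a p) = fls_const a + fls_X_inv * poly_fls p"
  by (simp add: poly_fls_def map_poly_pCons)

lemma poly_fls_nth: "fls_nth (poly_fls p) i = (if i \<le> 0 then coeff p (nat (- i)) else 0)"
proof (induction p arbitrary: i)
  case (pCons a p)
  have "nat (- i) = Suc (nat (- 1 - i))" if "i < 0"
    using that by simp
  then show ?case
    by (auto simp: poly_fls_pCons fls_X_inv_times_conv_shift pCons.IH add.commute)
qed simp

lemma poly_fls_1 [simp]: "poly_fls 1 = 1"
  by (rule fls_eqI) (simp add: poly_fls_nth)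

lemma poly_fls_add: "poly_fls (p + q) = poly_fls p + poly_fls q"
  by (rule fls_eqI) (simp add: poly_fls_nth)

lemma poly_fls_smult: "poly_fls (smult a p) = fls_const a * poly_fls p"
  by (rule fls_eqI) (simp add: poly_fls_nth)

lemma poly_fls_mult: "poly_fls (p * q) = poly_fls p * poly_fls q"
proof (induction p)
  case (pCons a p)
  then show ?case
    by (simp add: poly_fls_add poly_fls_smult poly_fls_pCons algebra_simps)
qed simp

lemma poly_fls_uminus: "poly_fls (- p) = - poly_fls p"
  by (rule fls_eqI) (simp add: poly_fls_nth)

lemma poly_fls_diff: "poly_fls (p - q) = poly_fls p - poly_fls q"
  by (rule fls_eqI) (simp add: poly_fls_nth)

lemma poly_fls_eq_0_iff [simp]: "poly_fls p = 0 \<longleftrightarrow> p = 0"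
proof
  assume *: "poly_fls p = 0"
  show "p = 0"
  proof (rule poly_eqI)
    fix n show "coeff p n = coeff 0 n"
      using poly_fls_nth[of p "- int n"] * by simp
  qed
qed simp

text \<open>The variable of the Laurent series is \<open>1/t\<close>, so that a pole of order \<open>n\<close> is a degree \<open>n\<close> in \<open>t\<close>.\<close>
lemma fls_subdegree_poly_fls: "fls_subdegree (poly_fls p) = - int (degree p)"
proof (cases "p = 0")
  case False
  show ?thesis
  proof (rule fls_subdegree_eqI)
    show "fls_nth (poly_fls p) (- int (degree p)) \<noteq> 0"
      using False by (simp add: poly_fls_nth)
    show "\<And>k. k < - int (degree p) \<Longrightarrow> fls_nth (poly_fls p) k = 0"
      by (auto simp: poly_fls_nth intro!: coeff_eq_0)
  qed
qed simp

text \<open>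
  With \<open>\<le>\<close> instead of \<open><\<close> this is an additive group for every \<open>n\<close>, because \<open>0\<close> has degree \<open>0\<close>.
\<close>
definition deg_le :: "nat \<Rightarrow> 'a::zero poly set" where
  "deg_le n = {p. degree p \<le> n}"

lemma pCons_le: "degree (pCons a p) \<le> Suc n \<longleftrightarrow> degree p \<le> n"
  by (cases "p = 0") auto

lemma deg_le_Suc: "deg_le (Suc n) = (\<lambda>(a, p). pCons a p) ` (UNIV \<times> deg_le n)"
proof (intro equalityI subsetI)
  fix p :: "'a poly" assume p: "p \<in> deg_le (Suc n)"
  obtain a q where "p = pCons a q" by (rule pCons_cases)
  with p show "p \<in> (\<lambda>(a, p). pCons a p) ` (UNIV \<times> deg_le n)"
    by (auto simp: deg_le_def split: if_splits intro!: image_eqI[of _ _ "(a, q)"])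
qed (auto simp: deg_le_def pCons_le)

lemma deg_le_0: "deg_le 0 = (\<lambda>a. [:a:]) ` UNIV"
  by (auto simp: deg_le_def elim: degree_eq_zeroE)

lemma finite_deg_le [simp]: "finite (deg_le n :: 'a::{finite,zero} poly set)"
  by (induction n) (auto simp: deg_le_Suc deg_le_0)

lemma CARD_dvd_card_deg_le: "CARD('a) dvd card (deg_le n :: 'a::{finite,zero} poly set)"
proof (cases n)
  case 0
  then show ?thesis by (simp add: deg_le_0 card_image inj_on_def)
next
  case (Suc m)
  have "inj_on (\<lambda>(a, p). pCons a p) (UNIV \<times> deg_le m :: ('a \<times> 'a poly) set)"
    by (auto simp: inj_on_def)
  then show ?thesis
    by (simp add: Suc deg_le_Suc card_image card_cartesian_product)
qed

lemma zero_in_deg_le [simp]: "0 \<in> deg_le n"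
  by (simp add: deg_le_def)

lemma deg_le_add: "p \<in> deg_le n \<Longrightarrow> q \<in> deg_le n \<Longrightarrow> p + q \<in> deg_le n"
  by (simp add: deg_le_def degree_add_le)

lemma deg_le_mono: "m \<le> n \<Longrightarrow> deg_le m \<subseteq> deg_le n"
  by (auto simp: deg_le_def)

lemma residues_eq_deg_le: "degree P > 0 \<Longrightarrow> {Q. degree Q < degree P} = deg_le (degree P - 1)"
  by (auto simp: deg_le_def)

text \<open>
  Division with remainder by \<open>P\<close> splits the polynomials of bounded degree into translates of a
  multiple of such a set. This is the combinatorial form of the isogeny \<open>z \<mapsto> P z\<close> below.
\<close>
lemma bij_betw_euclid_deg_le:
  fixes P :: "'a::field poly"
  assumes "degree P > 0"
  shows "bij_betw (\<lambda>(Q, l). Q + P * l) ({Q. degree Q < degree P} \<times> deg_le n)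
           (deg_le (n + degree P))"
proof (rule bij_betw_byWitness[where f' = "\<lambda>l. (l mod P, l div P)"])
  have P: "P \<noteq> 0" using assms by auto
  show "\<forall>x\<in>{Q. degree Q < degree P} \<times> deg_le n.
    (\<lambda>l. (l mod P, l div P)) ((\<lambda>(Q, l). Q + P * l) x) = x"
    using P by (auto simp: mod_poly_less div_poly_less poly_mod_add_left)
  show "\<forall>l\<in>deg_le (n + degree P). (\<lambda>(Q, l). Q + P * l) (l mod P, l div P) = l"
    by (simp add: mod_mult_div_eq)
  show "(\<lambda>(Q, l). Q + P * l) ` ({Q. degree Q < degree P} \<times> deg_le n) \<subseteq> deg_le (n + degree P)"
  proof clarify
    fix Q l :: "'a poly" assume "degree Q < degree P" "l \<in> deg_le n"
    moreover have "degree (P * l) \<le> degree P + degree l" by (rule degree_mult_le)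
    ultimately show "Q + P * l \<in> deg_le (n + degree P)"
      by (auto simp: deg_le_def intro!: degree_add_le)
  qed
  show "(\<lambda>l. (l mod P, l div P)) ` deg_le (n + degree P) \<subseteq> {Q. degree Q < degree P} \<times> deg_le n"
  proof clarify
    fix l :: "'a poly" assume "l \<in> deg_le (n + degree P)"
    moreover have mod: "degree (l mod P) < degree P"
      using degree_mod_less[OF P, of l] assms by auto
    ultimately have "degree (P * (l div P)) \<le> n + degree P"
      unfolding minus_mod_eq_mult_div[symmetric] by (intro degree_diff_le) (auto simp: deg_le_def)
    then show "l mod P \<in> {Q. degree Q < degree P} \<and> l div P \<in> deg_le n"
      using P mod by (cases "l div P = 0") (auto simp: degree_mult_eq deg_le_def)
  qed
qed

lemma irreducible_poly_degree_pos: "irreducible P \<Longrightarrow> degree P > 0"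
  for P :: "'a::field poly"
  by (metis irreducible_def is_unit_iff_degree neq0_conv)

text \<open>
  Multiplication by \<open>c\<close> is injective on the residues modulo the prime \<open>P\<close>, hence surjective, as there are
  finitely many of them.
\<close>
lemma inverse_mod_irreducible:
  fixes P c :: "'a::{finite,field} poly"
  assumes P: "irreducible P" and c: "\<not> P dvd c"
  obtains x where "P dvd c * x - 1"
proof -
  have prime: "prime_elem P" using P by (rule field_poly_irreducible_imp_prime)
  have P0: "P \<noteq> 0" using P by auto
  have deg: "degree P > 0" using P by (rule irreducible_poly_degree_pos)
  define R where "R = {Q::'a poly. degree Q < degree P}"
  have fin: "finite R" using deg by (simp add: R_def residues_eq_deg_le)
  have closed: "(c * Q) mod P \<in> R" for Q
    using degree_mod_less[OF P0, of "c * Q"] deg by (auto simp: R_def)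
  have "inj_on (\<lambda>Q. (c * Q) mod P) R"
  proof (rule inj_onI)
    fix Q Q' assume Q: "Q \<in> R" "Q' \<in> R" and "(c * Q) mod P = (c * Q') mod P"
    then have "P dvd c * (Q - Q')"
      by (simp add: mod_eq_dvd_iff right_diff_distrib)
    then have "P dvd Q - Q'" using c prime by (auto simp: prime_elem_dvd_mult_iff)
    moreover have "degree (Q - Q') < degree P"
      using Q by (auto simp: R_def intro: degree_diff_less)
    ultimately show "Q = Q'" using dvd_imp_degree[of P "Q - Q'"] P0 by fastforce
  qed
  then have "(\<lambda>Q. (c * Q) mod P) ` R = R"
    using closed by (intro endo_inj_surj[OF fin]) auto
  moreover have "1 \<in> R" using deg by (simp add: R_def)
  ultimately have "1 \<in> (\<lambda>Q. (c * Q) mod P) ` R" by simp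
  then obtain x where "(c * x) mod P = 1" by force
  then have "(c * x) mod P = 1 mod P" using deg by (simp add: mod_poly_less)
  then show ?thesis by (intro that) (simp add: mod_eq_dvd_iff)
qed

section \<open>Limits in a complete non-archimedean field\<close>

context C_infinity
begin

lemma abs_0 [simp]: "dist (0::'c) 0 = 0" by simp

lemma abs_1 [simp]: "dist (1::'c) 0 = 1"
proof -
  have "dist (1::'c) 0 * 1 = dist (1::'c) 0 * dist (1::'c) 0"
    using abs_mult[of 1 1] by (metis mult.right_neutral)
  then show ?thesis by (subst (asm) mult_cancel_left) auto
qed

lemma abs_uminus [simp]: "dist (- x :: 'c) 0 = dist x 0"
  by (metis dist_commute dist_diff diff_0)

lemma abs_power: "dist (x ^ n :: 'c) 0 = dist x 0 ^ n"
  by (induction n) (simp_all add: abs_mult)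

lemma abs_prod: "dist (prod f A :: 'c) 0 = (\<Prod>i\<in>A. dist (f i) 0)"
  by (induction A rule: infinite_finite_induct) (simp_all add: abs_mult)

lemma abs_inverse: "dist (inverse x :: 'c) 0 = inverse (dist x 0)"
proof (cases "x = 0")
  case False
  then show ?thesis using abs_mult[of x "inverse x"] by (simp add: field_simps)
qed simp

lemma abs_divide: "dist (x / y :: 'c) 0 = dist x 0 / dist y 0"
  by (simp add: divide_inverse abs_mult abs_inverse)

lemma abs_minus_commute: "dist (x - y :: 'c) 0 = dist (y - x) 0"
  by (metis abs_uminus minus_diff_eq)

lemma abs_add_le: "dist (x :: 'c) 0 \<le> B \<Longrightarrow> dist y 0 \<le> B \<Longrightarrow> dist (x + y) 0 \<le> B"
  using ultrametric[of x y] by simp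

lemma abs_diff_le: "dist (x :: 'c) 0 \<le> B \<Longrightarrow> dist y 0 \<le> B \<Longrightarrow> dist (x - y) 0 \<le> B"
  using abs_add_le[of x B "- y"] by simp

lemma abs_sum_le:
  "0 \<le> B \<Longrightarrow> (\<And>i. i \<in> A \<Longrightarrow> dist (f i :: 'c) 0 \<le> B) \<Longrightarrow> dist (sum f A) 0 \<le> B"
  by (induction A rule: infinite_finite_induct) (simp_all add: abs_add_le)

text \<open>
  The absolute value is locally constant away from \<open>0\<close>; infinite products and geometric series are
  controlled through this principle.
\<close>
lemma abs_eq_of_close: "dist (x - y :: 'c) 0 < dist y 0 \<Longrightarrow> dist x 0 = dist y 0"
proof (rule antisym)
  assume *: "dist (x - y) 0 < dist y 0"
  show "dist x 0 \<le> dist y 0"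
    using ultrametric[of "x - y" y] * by simp
  show "dist y 0 \<le> dist x 0"
    using ultrametric[of "y - x" x] * abs_minus_commute[of x y] by auto
qed

lemma tendsto_iff_abs: "(f \<longlongrightarrow> (l :: 'c)) F \<longleftrightarrow> ((\<lambda>x. dist (f x - l) 0) \<longlongrightarrow> 0) F"
  unfolding tendsto_dist_iff[of f l F] by (subst dist_diff) (rule refl)

lemma tendsto_add_C:
  assumes "(f \<longlongrightarrow> (l :: 'c)) F" "(g \<longlongrightarrow> m) F"
  shows "((\<lambda>x. f x + g x) \<longlongrightarrow> l + m) F"
proof -
  have "((\<lambda>x. max (dist (f x - l) 0) (dist (g x - m) 0)) \<longlongrightarrow> max 0 0) F"
    using assms by (intro tendsto_max) (simp_all add: tendsto_iff_abs)
  moreover have "dist (f x + g x - (l + m)) 0 \<le> max (dist (f x - l) 0) (dist (g x - m) 0)" for x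
    using ultrametric[of "f x - l" "g x - m"] by (simp add: algebra_simps)
  ultimately show ?thesis
    unfolding tendsto_iff_abs
    by (auto intro: Lim_null_comparison[of _ "\<lambda>x. max (dist (f x - l) 0) (dist (g x - m) 0)"])
qed

lemma tendsto_cmult_C:
  assumes "(f \<longlongrightarrow> (l :: 'c)) F"
  shows "((\<lambda>x. c * f x) \<longlongrightarrow> c * l) F"
proof -
  have "dist (c * f x - c * l) 0 = dist c 0 * dist (f x - l) 0" for x
    by (simp add: abs_mult flip: right_diff_distrib)
  then show ?thesis
    using tendsto_mult_right_zero[of "\<lambda>x. dist (f x - l) 0" F "dist c 0"] assms
    by (simp add: tendsto_iff_abs)
qed

lemma tendsto_mult_C:
  assumes "(f \<longlongrightarrow> (l :: 'c)) F" "(g \<longlongrightarrow> m) F"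
  shows "((\<lambda>x. f x * g x) \<longlongrightarrow> l * m) F"
proof -
  have "((\<lambda>x. dist (f x - l) 0 * dist (g x - m) 0) \<longlongrightarrow> 0 * 0) F"
    using assms by (intro tendsto_mult) (simp_all add: tendsto_iff_abs)
  then have "((\<lambda>x. (f x - l) * (g x - m)) \<longlongrightarrow> 0) F"
    by (simp add: tendsto_iff_abs[of _ 0] abs_mult)
  from tendsto_add_C[OF this tendsto_add_C[OF tendsto_cmult_C[OF assms(1), of m]
      tendsto_cmult_C[OF assms(2), of l]]]
  have "((\<lambda>x. (f x - l) * (g x - m) + (m * f x + l * g x)) \<longlongrightarrow> 0 + (m * l + l * m)) F" .
  from tendsto_add_C[OF this tendsto_const[of "- (l * m)"]]
  show ?thesis by (simp add: algebra_simps)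
qed

lemma tendsto_prod_C:
  assumes "\<And>i. i \<in> A \<Longrightarrow> (f i \<longlongrightarrow> (l i :: 'c)) F"
  shows "((\<lambda>x. \<Prod>i\<in>A. f i x) \<longlongrightarrow> (\<Prod>i\<in>A. l i)) F"
  using assms
  by (induction A rule: infinite_finite_induct) (auto intro!: tendsto_mult_C)

lemma iota_0 [simp]: "\<iota> 0 = 0"
  by (metis add_0 add_cancel_right_right hom_add)

lemma iota_uminus: "\<iota> (- f) = - \<iota> f"
  using hom_add[of f "- f"] by (simp add: eq_neg_iff_add_eq_0 add.commute)

lemma iota_diff: "\<iota> (f - g) = \<iota> f - \<iota> g"
  using hom_add[of f "- g"] by (simp add: iota_uminus)

lemma iota_eq_0_iff [simp]: "\<iota> f = 0 \<longleftrightarrow> f = 0"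
proof
  assume "\<iota> f = 0"
  then show "f = 0"
    using abs_extends[of f] by (cases "f = 0") auto
qed simp

lemma iota_inverse: "\<iota> (inverse f) = inverse (\<iota> f)"
proof (cases "f = 0")
  case False
  then have "\<iota> f * \<iota> (inverse f) = 1" by (simp add: hom_one flip: hom_mult)
  then show ?thesis by (simp add: inverse_unique)
qed simp

lemma iota_divide: "\<iota> (f / g) = \<iota> f / \<iota> g"
  by (simp add: divide_inverse hom_mult iota_inverse)

lemma cpoly_0: "cpoly \<iota> 0 = 0" by simp

lemma cpoly_1: "cpoly \<iota> 1 = 1" by (simp add: hom_one)

lemma cpoly_add: "cpoly \<iota> (p + q) = cpoly \<iota> p + cpoly \<iota> q"
  by (simp add: poly_fls_add hom_add)

lemma cpoly_mult: "cpoly \<iota> (p * q) = cpoly \<iota> p * cpoly \<iota> q"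
  by (simp add: poly_fls_mult hom_mult)

lemma cpoly_uminus: "cpoly \<iota> (- p) = - cpoly \<iota> p"
  by (simp add: poly_fls_uminus iota_uminus)

lemma cpoly_diff: "cpoly \<iota> (p - q) = cpoly \<iota> p - cpoly \<iota> q"
  by (simp add: poly_fls_diff iota_diff)

lemma cpoly_eq_iff [simp]: "cpoly \<iota> p = cpoly \<iota> q \<longleftrightarrow> p = q"
  by (metis cpoly_diff eq_iff_diff_eq_0 iota_eq_0_iff poly_fls_eq_0_iff)

lemma inj_cpoly: "inj_on (cpoly \<iota>) A"
  by (rule inj_onI) simp

lemma abs_cpoly: "p \<noteq> 0 \<Longrightarrow> dist (cpoly \<iota> p) 0 = real CARD('a) ^ degree p"
  by (simp add: abs_extends fls_subdegree_poly_fls)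

lemma CARD_gt_1: "real CARD('a) > 1"
proof -
  have "card {0, 1 :: 'a} \<le> CARD('a)" by (rule card_mono) auto
  then show ?thesis by simp
qed

text \<open>
  Translation by \<open>1\<close> permutes the finite field, so the sum of all its elements does not change when
  each of them is increased by \<open>1\<close>.
\<close>
lemma of_nat_CARD_eq_0: "of_nat CARD('a) = (0 :: 'c)"
proof -
  have "(\<Sum>x\<in>UNIV. x + 1) = (\<Sum>x\<in>UNIV. x :: 'a)"
    by (rule sum.reindex_bij_witness[of _ "\<lambda>x. x - 1" "\<lambda>x. x + 1"]) auto
  then have "of_nat CARD('a) = (0 :: 'a)" by (simp add: sum.distrib)
  moreover have "of_nat n = cpoly \<iota> [:of_nat n:]" for n
    by (induction n) (simp_all add: cpoly_add[symmetric] cpoly_1[symmetric] one_pCons del: iota_eq_0_iff poly_fls_1)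
  ultimately show ?thesis by simp
qed

lemma of_nat_card_deg_le: "of_nat (card (deg_le n :: 'a poly set)) = (0 :: 'c)"
  using CARD_dvd_card_deg_le[where ?'a = 'a, of n] of_nat_CARD_eq_0 by (auto elim!: dvdE)

end

section \<open>The Carlitz--Drinfeld exponential\<close>

text \<open>
  The polynomial \<open>E(X) = \<Prod>\<^sub>g (X - g)\<close> of a finite additive subgroup \<open>G\<close> is additive: \<open>E(X + y)\<close> and
  \<open>E(X) + E(y)\<close> are monic of the same degree \<open>|G|\<close> and agree at the \<open>|G|\<close> points of \<open>G\<close>, where \<open>E\<close>
  vanishes and which \<open>E(X + y)\<close> cannot distinguish.
\<close>
lemma prod_subgroup_additive:
  fixes G :: "'b::field set"
  assumes "finite G" "0 \<in> G" and add: "\<And>g h. g \<in> G \<Longrightarrow> h \<in> G \<Longrightarrow> g + h \<in> G"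
  shows "(\<Prod>g\<in>G. x + y - g) = (\<Prod>g\<in>G. x - g) + (\<Prod>g\<in>G. y - g)"
proof -
  have card: "card G > 0" using assms by (auto simp: card_gt_0_iff)
  have deg: "degree (\<Prod>g\<in>G. [:c - g, 1:]) = card G" for c :: 'b
    by (subst degree_prod_sum_eq) auto
  have lead: "coeff (\<Prod>g\<in>G. [:c - g, 1:]) (card G) = 1" for c :: 'b
    using lead_coeff_prod[of "\<lambda>g. [:c - g, 1:]" G] unfolding deg by simp
  have "(\<Prod>g\<in>G. [:y - g, 1:]) = (\<Prod>g\<in>G. [:0 - g, 1:]) + [:\<Prod>g\<in>G. y - g:]"
  proof (rule poly_eqI_degree_lead_coeff[where A = G and n = "card G"])
    show "coeff (\<Prod>g\<in>G. [:y - g, 1:]) (card G) =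
        coeff ((\<Prod>g\<in>G. [:0 - g, 1:]) + [:\<Prod>g\<in>G. y - g:]) (card G)"
      using card by (simp only: lead coeff_add) (simp add: coeff_pCons split: nat.split)
    show "degree ((\<Prod>g\<in>G. [:0 - g, 1:]) + [:\<Prod>g\<in>G. y - g:]) \<le> card G"
      by (intro degree_add_le) (simp_all only: deg, simp)
    fix h assume h: "h \<in> G"
    have "inj_on ((+) h) G" by simp
    moreover from this have "(+) h ` G = G"
      using assms h by (intro endo_inj_surj) auto
    ultimately have "(\<Prod>g\<in>G. h + y - g) = (\<Prod>g\<in>G. y - g)"
      using prod.reindex[of "(+) h" G "\<lambda>g. h + y - g"] by simp
    moreover have "(\<Prod>g\<in>G. h - g) = 0"
      using h assms(1) by (auto intro!: prod_zero)
    ultimately show "poly (\<Prod>g\<in>G. [:y - g, 1:]) h =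
        poly ((\<Prod>g\<in>G. [:0 - g, 1:]) + [:\<Prod>g\<in>G. y - g:]) h"
      by (simp add: poly_prod algebra_simps)
  qed (simp_all add: deg)
  then have "poly (\<Prod>g\<in>G. [:y - g, 1:]) x = poly ((\<Prod>g\<in>G. [:0 - g, 1:]) + [:\<Prod>g\<in>G. y - g:]) x"
    by (rule arg_cong)
  then show ?thesis by (simp add: poly_prod algebra_simps)
qed

context C_infinity
begin

text \<open>
  The finite stages of the exponential, over the subgroups \<open>deg_le n\<close> exhausting \<open>\<O>\<close>: functional
  equations of \<open>e\<^sub>\<O>\<close> are polynomial identities at finite stages that survive the limit.
\<close>
definition partial_exp :: "nat \<Rightarrow> 'c \<Rightarrow> 'c" where
  "partial_exp n z = z * (\<Prod>l\<in>deg_le n - {0}. 1 - z / cpoly \<iota> l)"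

lemma partial_exp_eq_prod:
  "partial_exp n z = (\<Prod>l\<in>deg_le n - {0}. - inverse (cpoly \<iota> l)) * (\<Prod>l\<in>deg_le n. z - cpoly \<iota> l)"
proof -
  have "(\<Prod>l\<in>deg_le n. z - cpoly \<iota> l) = z * (\<Prod>l\<in>deg_le n - {0}. z - cpoly \<iota> l)"
    by (subst prod.remove[of _ 0]) auto
  moreover have "(\<Prod>l\<in>deg_le n - {0}. 1 - z / cpoly \<iota> l) =
      (\<Prod>l\<in>deg_le n - {0}. - inverse (cpoly \<iota> l)) * (\<Prod>l\<in>deg_le n - {0}. z - cpoly \<iota> l)"
    unfolding prod.distrib[symmetric] by (intro prod.cong) (auto simp: field_simps)
  ultimately show ?thesis by (simp add: partial_exp_def)
qed

lemma partial_exp_add: "partial_exp n (x + y) = partial_exp n x + partial_exp n y"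
proof -
  have 1: "(\<Prod>g\<in>cpoly \<iota> ` deg_le n. c - g) = (\<Prod>l\<in>deg_le n. c - cpoly \<iota> l)" for c
    using inj_cpoly by (subst prod.reindex) auto
  have "(\<Prod>l\<in>deg_le n. x + y - cpoly \<iota> l) = (\<Prod>l\<in>deg_le n. x - cpoly \<iota> l) + (\<Prod>l\<in>deg_le n. y - cpoly \<iota> l)"
    unfolding 1[symmetric]
    by (rule prod_subgroup_additive)
       (auto simp: image_iff cpoly_add[symmetric] intro: deg_le_add bexI[of _ 0])
  then show ?thesis by (simp add: partial_exp_eq_prod distrib_left)
qed

lemma prod_one_minus_small:
  fixes w :: "'i \<Rightarrow> 'c"
  assumes "finite F" "\<And>l. l \<in> F \<Longrightarrow> dist (w l) 0 \<le> \<delta>" "0 \<le> \<delta>" "\<delta> < 1"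
  shows "dist ((\<Prod>l\<in>F. 1 - w l) - 1) 0 \<le> \<delta>" and "dist (\<Prod>l\<in>F. 1 - w l) 0 = 1"
proof -
  show *: "dist ((\<Prod>l\<in>F. 1 - w l) - 1) 0 \<le> \<delta>"
    using assms
  proof (induction F)
    case (insert l F)
    have "dist (1 - w l) 0 = 1"
      using abs_eq_of_close[of "1 - w l" 1] insert.prems(1)[of l] insert.prems(3) by simp
    then have "dist ((1 - w l) * ((\<Prod>l\<in>F. 1 - w l) - 1)) 0 \<le> \<delta>"
      using insert by (simp add: abs_mult)
    then have "dist ((1 - w l) * ((\<Prod>l\<in>F. 1 - w l) - 1) - w l) 0 \<le> \<delta>"
      using insert.prems by (intro abs_diff_le) auto
    then show ?case using insert.hyps by (simp add: algebra_simps)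
  qed simp
  show "dist (\<Prod>l\<in>F. 1 - w l) 0 = 1"
    using abs_eq_of_close[of "\<Prod>l\<in>F. 1 - w l" 1] * assms by simp
qed

text \<open>
  Once \<open>F\<close> contains all \<open>l\<close> with \<open>|l| \<le> |z|\<close>, the remaining factors have absolute value \<open>1\<close>, and those
  with \<open>deg l > n\<close> are within \<open>|z|/q\<^sup>n\<close> of \<open>1\<close>. So the partial products form a Cauchy net of eventually constant absolute value
  \<open>M\<close>, and the limit has absolute value \<open>M\<close>, which is nonzero unless some factor vanishes.
\<close>
lemma exp_product_converges:
  obtains L where
    "((\<lambda>F. \<Prod>l\<in>F. 1 - z / cpoly \<iota> l) \<longlongrightarrow> L) (finite_subsets_at_top (UNIV - {0}))"
    "(\<lambda>n. \<Prod>l\<in>deg_le n - {0}. 1 - z / cpoly \<iota> l) \<longlonglongrightarrow> L"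
    "z \<notin> range (cpoly \<iota>) \<longrightarrow> L \<noteq> 0"
proof -
  let ?q = "real CARD('a)"
  define g where "g F = (\<Prod>l\<in>F. 1 - z / cpoly \<iota> l)" for F
  define D where "D n = (deg_le n - {0} :: 'a poly set)" for n
  \<comment> \<open>All lattice points of absolute value at most \<open>|z|\<close> belong to \<open>D N\<close>.\<close>
  obtain N where N: "dist z 0 < ?q ^ N"
    using real_arch_pow[OF CARD_gt_1] by blast
  define M where "M = dist (g (D N)) 0"
  define \<delta> where "\<delta> n = dist z 0 / ?q ^ n" for n
  have \<delta>: "0 \<le> \<delta> n" "n \<ge> N \<Longrightarrow> \<delta> n < 1" for n
  proof -
    show "0 \<le> \<delta> n" by (simp add: \<delta>_def)
    assume "n \<ge> N"
    then have "?q ^ N \<le> ?q ^ n" using CARD_gt_1 by (intro power_increasing) auto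
    with N have "dist z 0 < ?q ^ n" by linarith
    then show "\<delta> n < 1" using CARD_gt_1 by (simp add: \<delta>_def)
  qed
  have small: "dist (z / cpoly \<iota> l) 0 \<le> \<delta> n" if "l \<notin> D n" "l \<noteq> 0" for l n
  proof -
    have "n \<le> degree l" using that by (auto simp: D_def deg_le_def)
    then have "?q ^ n \<le> ?q ^ degree l" using CARD_gt_1 by (intro power_increasing) auto
    then show ?thesis using that(2) CARD_gt_1
      by (auto simp: abs_divide abs_cpoly \<delta>_def intro!: divide_left_mono)
  qed
  have split: "g F = g (D n) * g (F - D n)" if "finite F" "D n \<subseteq> F" for F n
    using that unfolding g_def by (subst prod.subset_diff[of "D n" F]) (auto simp: mult.commute)
  have tail: "dist (g (F - D n) - 1) 0 \<le> \<delta> n" "dist (g (F - D n)) 0 = 1"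
    if "finite F" "0 \<notin> F" "n \<ge> N" for F n
    unfolding g_def using that small \<delta>
    by (intro prod_one_minus_small[of _ _ "\<delta> n"]; force)+
  have abs_g: "dist (g F) 0 = M" if "finite F" "0 \<notin> F" "D N \<subseteq> F" for F
    using tail(2)[of F N] that by (simp add: split[of F N] abs_mult M_def)
  have DN: "D N \<subseteq> D n" if "n \<ge> N" for n
    using deg_le_mono[OF that] by (auto simp: D_def)
  have finD: "finite (D n)" "0 \<notin> D n" for n by (auto simp: D_def)
  have M0: "0 \<le> M" by (simp add: M_def)
  have close: "dist (g F) (g (D n)) \<le> M * \<delta> n"
    if "finite F" "0 \<notin> F" "n \<ge> N" "D n \<subseteq> F" for F n
  proof -
    have "dist (g F) (g (D n)) = dist (g (D n) * (g (F - D n) - 1)) 0"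
      using split[of F n] that by (subst dist_diff) (simp add: algebra_simps)
    also have "\<dots> \<le> M * \<delta> n"
      using tail(1)[OF that(1-3)] abs_g[OF finD DN[OF that(3)]] M0
      by (auto simp: abs_mult intro!: mult_left_mono)
    finally show ?thesis .
  qed
  have lim0: "(\<lambda>n. M * \<delta> n) \<longlonglongrightarrow> 0"
    using LIMSEQ_inverse_realpow_zero[OF CARD_gt_1, THEN tendsto_mult_right_zero, of "M * dist z 0"]
    by (simp add: \<delta>_def field_simps)
  have ev0: "\<forall>\<^sub>F n in sequentially. M * \<delta> n < e" if "e > 0" for e
    using order_tendstoD(2)[OF lim0 that] .
  have "Cauchy (\<lambda>n. g (D n))"
  proof (rule CauchyI')
    fix e :: real assume "e > 0"
    then have "\<forall>\<^sub>F n in sequentially. M * \<delta> n < e / 2 \<and> n \<ge> N"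
      by (intro eventually_conj ev0 eventually_ge_at_top) auto
    then obtain n where n: "M * \<delta> n < e / 2" "n \<ge> N"
      by (metis (no_types, lifting) eventually_happens sequentially_bot)
    have near: "dist (g (D m)) (g (D n)) < e / 2" if "m \<ge> n" for m
    proof -
      have "D n \<subseteq> D m" using deg_le_mono[OF that] by (auto simp: D_def)
      then show ?thesis using close[OF finD n(2)] n(1) by (meson le_less_trans)
    qed
    have "dist (g (D m)) (g (D m')) < e" if "m \<ge> n" "m' \<ge> n" for m m'
      using near[OF that(1)] near[OF that(2)] dist_triangle2[of "g (D m)" "g (D m')" "g (D n)"]
      by linarith
    then show "\<exists>M. \<forall>m\<ge>M. \<forall>n>m. dist (g (D m)) (g (D n)) < e"
      by (intro exI[of _ n]) auto
  qed
  then obtain L where L: "(\<lambda>n. g (D n)) \<longlonglongrightarrow> L"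
    using Cauchy_convergent convergent_def by blast
  have "(g \<longlongrightarrow> L) (finite_subsets_at_top (UNIV - {0}))"
  proof (rule tendstoI)
    fix e :: real assume "e > 0"
    have "\<forall>\<^sub>F n in sequentially. M * \<delta> n < e / 2 \<and> dist (g (D n)) L < e / 2 \<and> n \<ge> N"
      using \<open>e > 0\<close> by (intro eventually_conj ev0 tendstoD[OF L] eventually_ge_at_top) auto
    then obtain n where n: "M * \<delta> n < e / 2" "dist (g (D n)) L < e / 2" "n \<ge> N"
      by (metis (no_types, lifting) eventually_happens sequentially_bot)
    show "\<forall>\<^sub>F F in finite_subsets_at_top (UNIV - {0}). dist (g F) L < e"
      unfolding eventually_finite_subsets_at_top
    proof (intro exI[of _ "D n"] conjI allI impI)
      fix F assume "finite F \<and> D n \<subseteq> F \<and> F \<subseteq> UNIV - {0}"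
      then have "dist (g F) (g (D n)) \<le> M * \<delta> n" using n by (intro close) auto
      then show "dist (g F) L < e" using n dist_triangle[of "g F" L "g (D n)"] by linarith
    qed (auto simp: D_def)
  qed
  moreover have "L \<noteq> 0" if "z \<notin> range (cpoly \<iota>)"
  proof -
    have "M > 0"
      using that by (auto simp: M_def g_def abs_prod D_def finD intro!: prod_pos)
    then have "\<forall>\<^sub>F n in sequentially. dist (g (D n)) L < M \<and> n \<ge> N"
      by (intro eventually_conj tendstoD[OF L] eventually_ge_at_top)
    then obtain n where n: "dist (g (D n)) L < M" "n \<ge> N"
      by (metis (no_types, lifting) eventually_happens sequentially_bot)
    then show ?thesis using abs_g[OF finD DN, of n] by auto
  qed
  ultimately show ?thesis using L by (intro that) (auto simp: g_def[abs_def] D_def)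
qed

lemma partial_exp_tendsto: "(\<lambda>n. partial_exp n z) \<longlonglongrightarrow> exp_lattice \<iota> UNIV z"
  and exp_UNIV_nonzero: "z \<notin> range (cpoly \<iota>) \<Longrightarrow> exp_lattice \<iota> UNIV z \<noteq> 0"
proof -
  obtain L where L: "((\<lambda>F. \<Prod>l\<in>F. 1 - z / cpoly \<iota> l) \<longlongrightarrow> L) (finite_subsets_at_top (UNIV - {0}))"
    "(\<lambda>n. \<Prod>l\<in>deg_le n - {0}. 1 - z / cpoly \<iota> l) \<longlonglongrightarrow> L"
    "z \<notin> range (cpoly \<iota>) \<longrightarrow> L \<noteq> 0"
    by (rule exp_product_converges[of z])
  have eq: "exp_lattice \<iota> UNIV z = z * L"
    unfolding exp_lattice_def using tendsto_Lim[OF _ L(1)] by simp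
  show "(\<lambda>n. partial_exp n z) \<longlonglongrightarrow> exp_lattice \<iota> UNIV z"
    unfolding partial_exp_def eq by (rule tendsto_cmult_C[OF L(2)])
  show "exp_lattice \<iota> UNIV z \<noteq> 0" if "z \<notin> range (cpoly \<iota>)"
    using L(3) that cpoly_0 unfolding eq by (metis mult_eq_0_iff rangeI)
qed

lemma exp_UNIV_add: "exp_lattice \<iota> UNIV (x + y) = exp_lattice \<iota> UNIV x + exp_lattice \<iota> UNIV y"
  using tendsto_add_C[OF partial_exp_tendsto[of x] partial_exp_tendsto[of y]]
    partial_exp_tendsto[of "x + y"]
  by (simp add: partial_exp_add LIMSEQ_unique)

lemma exp_UNIV_diff: "exp_lattice \<iota> UNIV (x - y) = exp_lattice \<iota> UNIV x - exp_lattice \<iota> UNIV y"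
  using exp_UNIV_add[of "x - y" y] by (simp add: algebra_simps)

text \<open>
  The map \<open>l \<mapsto> P l\<close> carries the product for \<open>\<O>\<close> at \<open>z\<close> to the product for \<open>P\<O>\<close> at \<open>P z\<close>, factor by
  factor.
\<close>
lemma exp_multiples:
  assumes "P \<noteq> 0"
  shows "exp_lattice \<iota> {l. P dvd l} (cpoly \<iota> P * z) = cpoly \<iota> P * exp_lattice \<iota> UNIV z"
proof -
  have inj: "inj_on (\<lambda>l. P * l) A" for A using assms by (simp add: inj_on_def)
  have img: "{l. P dvd l} - {0} = (\<lambda>l. P * l) ` (UNIV - {0})"
    using assms by (auto elim!: dvdE)
  have "(\<Prod>l\<in>(\<lambda>l. P * l) ` F. 1 - cpoly \<iota> P * z / cpoly \<iota> l) = (\<Prod>l\<in>F. 1 - z / cpoly \<iota> l)" for F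
    using assms by (simp add: prod.reindex[OF inj] cpoly_mult)
  then have "((\<lambda>F. \<Prod>l\<in>F. 1 - cpoly \<iota> P * z / cpoly \<iota> l) \<longlongrightarrow> L) (finite_subsets_at_top ({l. P dvd l} - {0}))
     \<longleftrightarrow> ((\<lambda>F. \<Prod>l\<in>F. 1 - z / cpoly \<iota> l) \<longlongrightarrow> L) (finite_subsets_at_top (UNIV - {0}))" for L
    unfolding img filtermap_image_finite_subsets_at_top[OF inj, symmetric] filterlim_filtermap by simp
  then have "Lim (finite_subsets_at_top ({l. P dvd l} - {0})) (\<lambda>F. \<Prod>l\<in>F. 1 - cpoly \<iota> P * z / cpoly \<iota> l)
      = Lim (finite_subsets_at_top (UNIV - {0})) (\<lambda>F. \<Prod>l\<in>F. 1 - z / cpoly \<iota> l)"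
    by (simp only: t2_space_class.Lim_def)
  then show ?thesis unfolding exp_lattice_def by (simp only: mult.assoc)
qed

text \<open>
  Let \<open>e\<close> stand for the finite stages. The factors of \<open>e(P z)\<close> are grouped by the residue \<open>Q\<close> of \<open>l\<close> modulo \<open>P\<close>. The group of \<open>Q\<close> consists of
  the factors \<open>1 - P z / (Q + P l)\<close>, and the product of these is \<open>e(z - Q/P) / e(-Q/P)\<close>, except that
  \<open>Q = 0\<close> contributes \<open>P e(z)\<close>. The denominators are moved to the left-hand side so that the passage to the
  limit involves only products.
\<close>
lemma partial_exp_mult:
  assumes "degree P > 0"
  shows "partial_exp (n + degree P) (cpoly \<iota> P * z) *
      (\<Prod>Q | degree Q < degree P \<and> Q \<noteq> 0. partial_exp n (- cpoly \<iota> Q / cpoly \<iota> P)) =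
    cpoly \<iota> P * (\<Prod>Q | degree Q < degree P. partial_exp n (z - cpoly \<iota> Q / cpoly \<iota> P))"
proof -
  have P: "P \<noteq> 0" using assms by auto
  let ?R = "{Q :: 'a poly. degree Q < degree P}"
  define C where "C = (\<Prod>l\<in>deg_le n - {0}. - inverse (cpoly \<iota> l))"
  define f where "f l = 1 - cpoly \<iota> P * z / cpoly \<iota> l" for l
  have finR: "finite ?R" using assms by (simp add: residues_eq_deg_le)
  have fac: "(\<Prod>l\<in>deg_le n. f (Q + P * l)) * partial_exp n (- cpoly \<iota> Q / cpoly \<iota> P)
      = partial_exp n (z - cpoly \<iota> Q / cpoly \<iota> P)" if "Q \<in> ?R" "Q \<noteq> 0" for Q
  proof -
    have "f (Q + P * l) * (- cpoly \<iota> Q / cpoly \<iota> P - cpoly \<iota> l) =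
        z - cpoly \<iota> Q / cpoly \<iota> P - cpoly \<iota> l" for l
    proof -
      have "Q + P * l \<noteq> 0"
      proof
        assume "Q + P * l = 0"
        then have "P dvd Q" by (metis add_eq_0_iff2 dvd_minus_iff dvd_triv_left)
        with that show False using dvd_imp_degree[of P Q] P by auto
      qed
      moreover have "cpoly \<iota> Q / cpoly \<iota> P + cpoly \<iota> l = cpoly \<iota> (Q + P * l) / cpoly \<iota> P"
        using P by (simp add: cpoly_add cpoly_mult field_simps)
      ultimately show ?thesis
        using P unfolding minus_divide_left[symmetric] minus_add_distrib[symmetric]
          diff_conv_add_uminus[of "- _"] diff_diff_eq by (simp add: f_def field_simps)
    qed
    then show ?thesis
      unfolding partial_exp_eq_prod C_def[symmetric] mult.left_commute[of _ C] prod.distrib[symmetric]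
      by simp
  qed
  have fac0: "cpoly \<iota> P * z * (\<Prod>l\<in>deg_le n - {0}. f (P * l)) = cpoly \<iota> P * partial_exp n z"
    using P by (auto simp: f_def partial_exp_def cpoly_mult intro!: prod.cong)
  \<comment> \<open>As \<open>1 / 0 = 0\<close>, the factor \<open>f 0\<close> is \<open>1\<close> and may be included in the product.\<close>
  have "partial_exp (n + degree P) (cpoly \<iota> P * z) =
     cpoly \<iota> P * z * (\<Prod>l\<in>deg_le (n + degree P) - {0}. f l)"
    by (simp add: partial_exp_def f_def)
  also have "(\<Prod>l\<in>deg_le (n + degree P) - {0}. f l) = (\<Prod>l\<in>deg_le (n + degree P). f l)"
    using prod.remove[of "deg_le (n + degree P)" 0 f] by (simp add: f_def)
  also have "\<dots> = (\<Prod>(Q, l)\<in>?R \<times> deg_le n. f (Q + P * l))"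
    using prod.reindex_bij_betw[OF bij_betw_euclid_deg_le[OF assms, of n], of f]
    by (simp add: case_prod_unfold)
  also have "\<dots> = (\<Prod>Q\<in>?R. \<Prod>l\<in>deg_le n. f (Q + P * l))"
    by (simp add: prod.cartesian_product)
  also have "\<dots> = (\<Prod>l\<in>deg_le n. f (P * l)) * (\<Prod>Q\<in>?R - {0}. \<Prod>l\<in>deg_le n. f (Q + P * l))"
    using finR assms by (subst prod.remove[of _ 0]) auto
  also have "(\<Prod>l\<in>deg_le n. f (P * l)) = (\<Prod>l\<in>deg_le n - {0}. f (P * l))"
    using prod.remove[of "deg_le n" 0 "\<lambda>l. f (P * l)"] by (simp add: f_def)
  finally have "partial_exp (n + degree P) (cpoly \<iota> P * z) = cpoly \<iota> P * partial_exp n z *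
      (\<Prod>Q\<in>?R - {0}. \<Prod>l\<in>deg_le n. f (Q + P * l))"
    by (simp only: mult.assoc[symmetric] fac0)
  moreover have "(\<Prod>Q\<in>?R - {0}. \<Prod>l\<in>deg_le n. f (Q + P * l)) *
      (\<Prod>Q\<in>?R - {0}. partial_exp n (- cpoly \<iota> Q / cpoly \<iota> P)) =
      (\<Prod>Q\<in>?R - {0}. partial_exp n (z - cpoly \<iota> Q / cpoly \<iota> P))"
    unfolding prod.distrib[symmetric] using fac by (intro prod.cong) auto
  moreover have "(\<Prod>Q\<in>?R. partial_exp n (z - cpoly \<iota> Q / cpoly \<iota> P)) = partial_exp n z *
      (\<Prod>Q\<in>?R - {0}. partial_exp n (z - cpoly \<iota> Q / cpoly \<iota> P))"
    using finR assms by (subst prod.remove[of _ 0]) auto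
  moreover have "{Q. degree Q < degree P \<and> Q \<noteq> 0} = ?R - {0}" by auto
  ultimately show ?thesis by (simp add: mult.assoc)
qed

lemma exp_UNIV_mult:
  assumes "degree P > 0"
  shows "exp_lattice \<iota> UNIV (cpoly \<iota> P * z) *
      (\<Prod>Q | degree Q < degree P \<and> Q \<noteq> 0. exp_lattice \<iota> UNIV (- cpoly \<iota> Q / cpoly \<iota> P)) =
    cpoly \<iota> P * (\<Prod>Q | degree Q < degree P. exp_lattice \<iota> UNIV (z - cpoly \<iota> Q / cpoly \<iota> P))"
proof (rule LIMSEQ_unique)
  show "(\<lambda>n. cpoly \<iota> P * (\<Prod>Q | degree Q < degree P. partial_exp n (z - cpoly \<iota> Q / cpoly \<iota> P)))
     \<longlonglongrightarrow> cpoly \<iota> P * (\<Prod>Q | degree Q < degree P. exp_lattice \<iota> UNIV (z - cpoly \<iota> Q / cpoly \<iota> P))"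
    by (intro tendsto_cmult_C tendsto_prod_C partial_exp_tendsto)
  have "(\<lambda>n. partial_exp (n + degree P) (cpoly \<iota> P * z)) \<longlonglongrightarrow> exp_lattice \<iota> UNIV (cpoly \<iota> P * z)"
    by (rule LIMSEQ_ignore_initial_segment[OF partial_exp_tendsto])
  then show "(\<lambda>n. cpoly \<iota> P * (\<Prod>Q | degree Q < degree P. partial_exp n (z - cpoly \<iota> Q / cpoly \<iota> P)))
     \<longlonglongrightarrow> exp_lattice \<iota> UNIV (cpoly \<iota> P * z) *
      (\<Prod>Q | degree Q < degree P \<and> Q \<noteq> 0. exp_lattice \<iota> UNIV (- cpoly \<iota> Q / cpoly \<iota> P))"
    unfolding partial_exp_mult[OF assms, symmetric]
    by (intro tendsto_mult_C tendsto_prod_C partial_exp_tendsto)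
qed

end

section \<open>Substitution in convergent power series\<close>

context C_infinity
begin

text \<open>
  A quantitative form of ``\<open>V\<close> converges to \<open>v\<close> at \<open>u\<close>''. The bound \<open>t ^ N\<close> carries no constant and is
  therefore inherited by all products and powers with the same \<open>t\<close>; a bound that is uniform in the
  exponent is what the rearrangement of a double series requires.
\<close>
definition fps_tail_bound :: "real \<Rightarrow> 'c \<Rightarrow> 'c fps \<Rightarrow> 'c \<Rightarrow> bool" where
  "fps_tail_bound t u V v \<longleftrightarrow> (\<forall>N. dist (v - (\<Sum>j<N. fps_nth V j * u ^ j)) 0 \<le> t ^ N)"

lemma fps_tail_bound_value: "fps_tail_bound t u V v \<Longrightarrow> dist v 0 \<le> 1"
  unfolding fps_tail_bound_def by (drule spec[of _ 0]) simp

lemma fps_tail_bound_term: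
  assumes "fps_tail_bound t u V v" "0 \<le> t" "t \<le> 1"
  shows "dist (fps_nth V j * u ^ j) 0 \<le> t ^ j"
proof -
  let ?r = "\<lambda>N. v - (\<Sum>j<N. fps_nth V j * u ^ j)"
  have "dist (?r j) 0 \<le> t ^ j" "dist (?r (Suc j)) 0 \<le> t ^ Suc j"
    using assms(1) unfolding fps_tail_bound_def by blast+
  moreover have "t ^ Suc j \<le> t ^ j" using assms by (simp add: mult_left_le_one_le)
  ultimately have "dist (?r j - ?r (Suc j)) 0 \<le> t ^ j"
    by (meson abs_diff_le order_trans)
  then show ?thesis by simp
qed

lemma fps_tail_bound_one: "0 \<le> t \<Longrightarrow> fps_tail_bound t u 1 1"
  unfolding fps_tail_bound_def
proof
  fix N assume "0 \<le> t"
  have "(\<Sum>j<N. fps_nth 1 j * u ^ j) = (if N = 0 then 0 else 1)"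
    by (cases N) (auto simp: sum.lessThan_Suc_shift simp del: sum.lessThan_Suc)
  then show "dist (1 - (\<Sum>j<N. fps_nth 1 j * u ^ j)) 0 \<le> t ^ N"
    using \<open>0 \<le> t\<close> by simp
qed

text \<open>
  The remainder of a product is \<open>(v - \<Sum>\<^sub>i V\<^sub>i u\<^sup>i) w + \<Sum>\<^sub>i V\<^sub>i u\<^sup>i (w - \<Sum>\<^sub>j W\<^sub>j u\<^sup>j)\<close>, with \<open>i < N\<close> and
  \<open>j < N - i\<close>, and the ultrametric inequality bounds it by its largest term.
\<close>
lemma fps_tail_bound_mult:
  assumes V: "fps_tail_bound t u V v" and W: "fps_tail_bound t u W w" and t: "0 \<le> t" "t \<le> 1"
  shows "fps_tail_bound t u (V * W) (v * w)"
  unfolding fps_tail_bound_def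
proof
  fix N
  let ?V = "\<lambda>i. fps_nth V i * u ^ i" and ?W = "\<lambda>j. fps_nth W j * u ^ j"
  have "(\<Sum>j<N. fps_nth (V * W) j * u ^ j) = (\<Sum>j<N. \<Sum>i\<le>j. ?V i * ?W (j - i))"
  proof (intro sum.cong refl)
    fix j
    show "fps_nth (V * W) j * u ^ j = (\<Sum>i\<le>j. ?V i * ?W (j - i))"
      unfolding fps_mult_nth sum_distrib_right atLeast0AtMost
    proof (intro sum.cong refl)
      fix i assume "i \<in> {..j}"
      then have "u ^ j = u ^ i * u ^ (j - i)" by (simp flip: power_add)
      then show "fps_nth V i * fps_nth W (j - i) * u ^ j = ?V i * ?W (j - i)"
        by (simp add: mult_ac)
    qed
  qed
  also have "\<dots> = (\<Sum>(i, j)\<in>{(i, j). i + j < N}. ?V i * ?W j)"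
    by (rule sum.triangle_reindex[symmetric])
  also have "{(i, j). i + j < N} = (SIGMA i:{..<N}. {..<N - i})"
    by auto
  also have "(\<Sum>(i, j)\<in>(SIGMA i:{..<N}. {..<N - i}). ?V i * ?W j) = (\<Sum>i<N. \<Sum>j<N - i. ?V i * ?W j)"
    by (subst sum.Sigma) auto
  finally have trunc: "(\<Sum>j<N. fps_nth (V * W) j * u ^ j) = (\<Sum>i<N. ?V i * (\<Sum>j<N - i. ?W j))"
    by (simp add: sum_distrib_left)
  have "v * w - (\<Sum>j<N. fps_nth (V * W) j * u ^ j) =
      (v - (\<Sum>i<N. ?V i)) * w + (\<Sum>i<N. ?V i * (w - (\<Sum>j<N - i. ?W j)))"
    unfolding trunc by (simp add: algebra_simps sum_subtractf sum_distrib_left)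
  moreover have "dist ((v - (\<Sum>i<N. ?V i)) * w) 0 \<le> t ^ N * 1"
    unfolding abs_mult using V fps_tail_bound_value[OF W] t
    by (intro mult_mono) (auto simp: fps_tail_bound_def)
  moreover have "dist (\<Sum>i<N. ?V i * (w - (\<Sum>j<N - i. ?W j))) 0 \<le> t ^ N"
  proof (rule abs_sum_le)
    fix i assume i: "i \<in> {..<N}"
    have "dist (?V i * (w - (\<Sum>j<N - i. ?W j))) 0 \<le> t ^ i * t ^ (N - i)"
      unfolding abs_mult[of "?V i"] using fps_tail_bound_term[OF V t, of i] W t
      by (intro mult_mono) (auto simp: fps_tail_bound_def)
    also have "\<dots> = t ^ N" using i by (simp flip: power_add)
    finally show "dist (?V i * (w - (\<Sum>j<N - i. ?W j))) 0 \<le> t ^ N" .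
  qed (use t in simp)
  ultimately show "dist (v * w - (\<Sum>j<N. fps_nth (V * W) j * u ^ j)) 0 \<le> t ^ N"
    by (simp add: abs_add_le)
qed

lemma fps_tail_bound_prod:
  assumes "\<And>i. i \<in> I \<Longrightarrow> fps_tail_bound t u (V i) (v i)" "0 \<le> t" "t \<le> 1"
  shows "fps_tail_bound t u (\<Prod>i\<in>I. V i) (\<Prod>i\<in>I. v i)"
  using assms
  by (induction I rule: infinite_finite_induct)
     (auto intro: fps_tail_bound_one fps_tail_bound_mult)

lemma fps_tail_bound_power:
  "fps_tail_bound t u V v \<Longrightarrow> 0 \<le> t \<Longrightarrow> t \<le> 1 \<Longrightarrow> fps_tail_bound t u (V ^ n) (v ^ n)"
  by (induction n) (auto intro: fps_tail_bound_one fps_tail_bound_mult)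

text \<open>The series is \<open>u / (1 - w u) = \<Sum>\<^sub>j w\<^sup>j\<^sup>-\<^sup>1 u\<^sup>j\<close>, over \<open>j \<ge> 1\<close>, with remainder \<open>v (w u)\<^sup>n\<close> after \<open>n\<close> terms.\<close>
lemma fps_tail_bound_geometric:
  assumes "dist u 0 \<le> t" "dist (w * u) 0 \<le> t" "t < 1"
  shows "fps_tail_bound t u (Abs_fps (\<lambda>j. if j = 0 then 0 else w ^ (j - 1))) (u / (1 - w * u))"
proof -
  define v where "v = u / (1 - w * u)"
  let ?V = "Abs_fps (\<lambda>j. if j = 0 then 0 else w ^ (j - 1))"
  have one: "dist (1 - w * u) 0 = 1"
    using abs_eq_of_close[of "1 - w * u" 1] assms by simp
  then have "1 - w * u \<noteq> 0" by (metis abs_0 zero_neq_one)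
  then have "v * (1 - w * u) = u" unfolding v_def by simp
  then have v: "v - u = v * (w * u)" by (simp add: algebra_simps)
  have abs_v: "dist v 0 = dist u 0" by (simp add: v_def abs_divide one)
  have tail: "v - (\<Sum>j<Suc n. fps_nth ?V j * u ^ j) = v * (w * u) ^ n" for n
  proof (induction n)
    case (Suc n)
    have "v - (\<Sum>j<Suc (Suc n). fps_nth ?V j * u ^ j) = v * (w * u) ^ n - w ^ n * u ^ Suc n"
      using Suc by (simp add: algebra_simps)
    also have "\<dots> = (w * u) ^ n * (v - u)" by (simp add: algebra_simps)
    also have "\<dots> = v * (w * u) ^ Suc n" unfolding v by simp
    finally show ?case .
  qed simp
  have "dist (v - (\<Sum>j<N. fps_nth ?V j * u ^ j)) 0 \<le> t ^ N" for N
  proof (cases N)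
    case 0
    then show ?thesis using assms by (simp add: abs_v)
  next
    case (Suc n)
    have "dist u 0 * dist (w * u) 0 ^ n \<le> t * t ^ n"
      using assms by (intro mult_mono power_mono) (auto intro: order_trans[OF zero_le_dist])
    then show ?thesis unfolding Suc tail by (simp add: abs_mult[of v] abs_power abs_v)
  qed
  then show ?thesis unfolding fps_tail_bound_def v_def by blast
qed

lemma coefficient_growth:
  assumes "(\<lambda>n. a n * v ^ n) sums (s :: 'c)" "v \<noteq> 0"
  obtains A \<rho> where "A > 0" "\<rho> \<ge> 1" "\<And>n. dist (a n) 0 \<le> A * \<rho> ^ n"
proof -
  have "(\<lambda>N. \<Sum>n<N. a n * v ^ n) \<longlonglongrightarrow> s" using assms(1) by (simp add: sums_def)
  from tendsto_add_C[OF LIMSEQ_Suc[OF this] tendsto_cmult_C[OF this, of "-1"]]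
  have "(\<lambda>n. a n * v ^ n) \<longlonglongrightarrow> 0" by simp
  then have "(\<lambda>n. dist (a n * v ^ n) 0) \<longlonglongrightarrow> 0" by (simp add: tendsto_iff_abs[of _ 0])
  then have "Bseq (\<lambda>n. dist (a n * v ^ n) 0)"
    by (intro convergent_imp_Bseq convergentI)
  then obtain A where A: "A > 0" "\<And>n. dist (a n * v ^ n) 0 \<le> A"
    unfolding Bseq_def by auto
  define \<rho> where "\<rho> = max 1 (1 / dist v 0)"
  have v: "dist v 0 > 0" using assms(2) by simp
  have "dist (a n) 0 \<le> A * \<rho> ^ n" for n
  proof -
    have "dist (a n) 0 \<le> A * (1 / dist v 0) ^ n"
      using A(2)[of n] v by (simp add: abs_mult abs_power field_simps)
    also have "\<dots> \<le> A * \<rho> ^ n"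
      using A(1) v by (intro mult_left_mono power_mono) (auto simp: \<rho>_def)
    finally show ?thesis .
  qed
  then show ?thesis using A(1) by (intro that[of A \<rho>]) (auto simp: \<rho>_def)
qed

text \<open>
  Let \<open>V\<close> be the power series of \<open>v\<close> in \<open>u\<close>. The coefficients of the composed series are
  \<open>b\<^sub>j = \<Sum>\<^sub>n a\<^sub>n (V\<^sup>n)\<^sub>j\<close>, a finite sum as \<open>V\<close> has no constant term. Since \<open>|a\<^sub>n| \<le> A \<rho>\<^sup>n\<close>, the difference
  between the \<open>N\<close>-th partial sums of the two series is at most \<open>A (\<rho> t)\<^sup>N\<close> with \<open>t\<close> proportional to
  \<open>|u|\<close>, and tends to \<open>0\<close> when \<open>|u|\<close> is small. The growth bound requires a point of convergence with
  \<open>v \<noteq> 0\<close>.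
\<close>
lemma power_series_substitution:
  fixes u f :: "'x \<Rightarrow> 'c" and w :: "'i \<Rightarrow> 'c" and I :: "'i set"
  defines "v \<equiv> (\<lambda>z. \<Prod>i\<in>I. u z / (1 - w i * u z))"
  assumes I: "finite I" "I \<noteq> {}" and "r > 0" "a 0 = 0"
    and sums: "\<And>z. z \<in> S \<Longrightarrow> dist (v z) 0 < r \<Longrightarrow> (\<lambda>n. a n * v z ^ n) sums f z"
  obtains b s where "s > 0" "b 0 = 0"
    "\<And>z. z \<in> S \<Longrightarrow> dist (u z) 0 < s \<Longrightarrow> (\<lambda>n. b n * u z ^ n) sums f z"
proof -
  define C where "C = 1 + (\<Sum>i\<in>I. dist (w i) 0)"
  have C: "C \<ge> 1" by (simp add: C_def sum_nonneg)
  have wC: "dist (w i) 0 \<le> C" if "i \<in> I" for i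
    using member_le_sum[of i I "\<lambda>i. dist (w i) 0"] I that by (simp add: C_def)
  define V where "V i = Abs_fps (\<lambda>j. if j = 0 then 0 else w i ^ (j - 1))" for i
  have geo: "fps_tail_bound (C * dist (u z) 0) (u z) (V i) (u z / (1 - w i * u z))"
    if "i \<in> I" "C * dist (u z) 0 < 1" for i z
    unfolding V_def
  proof (rule fps_tail_bound_geometric)
    show "dist (u z) 0 \<le> C * dist (u z) 0" using C by (simp add: mult_le_cancel_right1)
    show "dist (w i * u z) 0 \<le> C * dist (u z) 0"
      using wC[OF that(1)] by (simp add: abs_mult mult_right_mono)
  qed fact
  have abs_v: "dist (v z) 0 < r" if "C * dist (u z) 0 < 1" "dist (u z) 0 < r" for z
  proof -
    have u1: "dist (u z) 0 < 1"
      using that(1) C mult_right_mono[OF C, of "dist (u z) 0"] by simp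
    have "dist (1 - w i * u z) 0 = 1" if i: "i \<in> I" for i
      using abs_eq_of_close[of "1 - w i * u z" 1] that(1) \<open>C * dist (u z) 0 < 1\<close>
        mult_right_mono[OF wC[OF i], of "dist (u z) 0"] by (simp add: abs_mult)
    then have "dist (v z) 0 = dist (u z) 0 ^ card I"
      by (simp add: v_def abs_prod abs_divide)
    also have "\<dots> \<le> dist (u z) 0 ^ 1"
      using u1 I by (intro power_decreasing) (auto simp: Suc_le_eq card_gt_0_iff)
    finally show ?thesis using that by simp
  qed
  show ?thesis
  proof (cases "\<exists>z\<in>S. v z \<noteq> 0 \<and> dist (v z) 0 < r")
    case False
    \<comment> \<open>Here the hypothesis only concerns points with \<open>v = 0\<close>, where \<open>f\<close> takes the value \<open>a 0 = 0\<close>.\<close>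
    have "(\<lambda>n. 0 * u z ^ n) sums f z" if "z \<in> S" "dist (u z) 0 < min r (1 / C)" for z
    proof -
      have "dist (v z) 0 < r" using that C by (intro abs_v) (auto simp: field_simps)
      moreover from this have "v z = 0" using False that by auto
      moreover have "(\<lambda>n. a n * 0 ^ n) = (\<lambda>n. 0 * u z ^ n)"
        using \<open>a 0 = 0\<close> by (auto simp: fun_eq_iff power_0_left)
      ultimately show ?thesis using sums[OF that(1)] by simp
    qed
    then show ?thesis using \<open>r > 0\<close> C by (intro that[of "min r (1 / C)" "\<lambda>_. 0"]) auto
  next
    case True
    then obtain z0 where "z0 \<in> S" "v z0 \<noteq> 0" "dist (v z0) 0 < r" by blast
    from coefficient_growth[OF sums[OF this(1,3)] this(2)]
    obtain A \<rho> where A: "A > 0" "\<rho> \<ge> 1" "\<And>n. dist (a n) 0 \<le> A * \<rho> ^ n" by blast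
    define VV where "VV = (\<Prod>i\<in>I. V i)"
    have VV0: "fps_nth VV 0 = 0"
      using I unfolding VV_def by (induction I rule: finite_ne_induct) (auto simp: V_def)
    have VV_power: "fps_nth (VV ^ n) j = 0" if "j < n" for n j
      using startsby_zero_power_prefix[OF VV0] that by blast
    define b where "b j = (\<Sum>n\<le>j. a n * fps_nth (VV ^ n) j)" for j
    define s where "s = min r (1 / (\<rho> * C))"
    have "(\<lambda>n. b n * u z ^ n) sums f z" if z: "z \<in> S" "dist (u z) 0 < s" for z
    proof -
      define t where "t = C * dist (u z) 0"
      have t: "0 \<le> t" "\<rho> * t < 1" "t < 1"
      proof -
        show "0 \<le> t" using C by (simp add: t_def)
        show "\<rho> * t < 1" using z A C by (simp add: t_def s_def field_simps)
        then show "t < 1" using \<open>0 \<le> t\<close> mult_right_mono[OF A(2), of t] by simp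
      qed
      have vr: "dist (v z) 0 < r"
        using z t by (intro abs_v) (auto simp: s_def t_def)
      have "fps_tail_bound t (u z) VV (v z)"
        unfolding VV_def v_def using t geo by (intro fps_tail_bound_prod) (auto simp: t_def)
      then have pow: "fps_tail_bound t (u z) (VV ^ n) (v z ^ n)" for n
        using t by (intro fps_tail_bound_power) auto
      have diff: "dist ((\<Sum>j<N. b j * u z ^ j) - (\<Sum>n<N. a n * v z ^ n)) 0 \<le> A * (\<rho> * t) ^ N" for N
      proof -
        have "(\<Sum>j<N. b j * u z ^ j) = (\<Sum>j<N. \<Sum>n<N. a n * (fps_nth (VV ^ n) j * u z ^ j))"
        proof (intro sum.cong refl)
          fix j assume "j \<in> {..<N}"
          then have "b j = (\<Sum>n<N. a n * fps_nth (VV ^ n) j)"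
            unfolding b_def by (intro sum.mono_neutral_left) (auto simp: VV_power)
          then show "b j * u z ^ j = (\<Sum>n<N. a n * (fps_nth (VV ^ n) j * u z ^ j))"
            by (simp add: sum_distrib_right mult.assoc)
        qed
        also have "\<dots> = (\<Sum>n<N. a n * (\<Sum>j<N. fps_nth (VV ^ n) j * u z ^ j))"
          by (subst sum.swap) (simp add: sum_distrib_left)
        finally have "(\<Sum>j<N. b j * u z ^ j) - (\<Sum>n<N. a n * v z ^ n) =
            - (\<Sum>n<N. a n * (v z ^ n - (\<Sum>j<N. fps_nth (VV ^ n) j * u z ^ j)))"
          by (simp add: right_diff_distrib sum_subtractf)
        moreover have "dist (\<Sum>n<N. a n * (v z ^ n - (\<Sum>j<N. fps_nth (VV ^ n) j * u z ^ j))) 0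
            \<le> A * (\<rho> * t) ^ N"
        proof (rule abs_sum_le)
          fix n assume n: "n \<in> {..<N}"
          have "dist (a n) 0 \<le> A * \<rho> ^ N"
            using A(3)[of n] A(1) power_increasing[OF _ A(2), of n N] n
            by (meson lessThan_iff less_imp_le mult_left_mono order_trans)
          then have "dist (a n) 0 * dist (v z ^ n - (\<Sum>j<N. fps_nth (VV ^ n) j * u z ^ j)) 0
              \<le> A * \<rho> ^ N * t ^ N"
            using pow[of n] A by (intro mult_mono) (auto simp: fps_tail_bound_def)
          then show "dist (a n * (v z ^ n - (\<Sum>j<N. fps_nth (VV ^ n) j * u z ^ j))) 0 \<le> A * (\<rho> * t) ^ N"
            by (simp add: abs_mult[of "a n"] power_mult_distrib mult.assoc)
        qed (use A t in auto)
        ultimately show ?thesis by simp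
      qed
      have "(\<lambda>N. A * (\<rho> * t) ^ N) \<longlonglongrightarrow> 0"
        using t A by (intro tendsto_mult_right_zero LIMSEQ_realpow_zero) auto
      then have "(\<lambda>N. dist ((\<Sum>j<N. b j * u z ^ j) - (\<Sum>n<N. a n * v z ^ n)) 0) \<longlonglongrightarrow> 0"
        by (rule Lim_null_comparison[rotated]) (use diff in auto)
      then have "(\<lambda>N. (\<Sum>j<N. b j * u z ^ j) - (\<Sum>n<N. a n * v z ^ n)) \<longlonglongrightarrow> 0"
        by (simp add: tendsto_iff_abs[of _ 0])
      from tendsto_add_C[OF this sums[OF z(1) vr, unfolded sums_def]]
      show ?thesis by (simp add: sums_def)
    qed
    moreover have "s > 0" using \<open>r > 0\<close> A C by (simp add: s_def)
    moreover have "b 0 = 0" using \<open>a 0 = 0\<close> by (simp add: b_def)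
    ultimately show ?thesis by (intro that[of s b])
  qed
qed

end

section \<open>Matrices and congruence subgroups\<close>

text \<open>Otherwise every matrix entry would be ambiguous with a coefficient of a power series.\<close>
no_notation fps_nth (infixl \<open>$\<close> 75)

lemma mat2_eta: "(\<gamma> :: 'b::zero^2^2) = mat2 (\<gamma>$1$1) (\<gamma>$1$2) (\<gamma>$2$1) (\<gamma>$2$2)"
  by (simp add: vec_eq_iff forall_2)

lemma mat2_cases:
  obtains a b c d where "(\<gamma> :: 'b::zero^2^2) = mat2 a b c d"
  by (rule that[OF mat2_eta])

lemma mat2_mult:
  "mat2 a b c d ** mat2 a' b' c' d' =
     (mat2 (a * a' + b * c') (a * b' + b * d') (c * a' + d * c') (c * b' + d * d') :: 'b::semiring_1^2^2)"
  by (simp add: vec_eq_iff forall_2 matrix_matrix_mult_def sum_2)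

lemma mat2_eq_iff: "mat2 a b c d = mat2 a' b' c' d' \<longleftrightarrow> a = a' \<and> b = b' \<and> c = c' \<and> d = (d' :: 'b::zero)"
  by (auto simp: vec_eq_iff forall_2)

lemma det_mat2: "det (mat2 a b c d) = a * d - b * (c :: 'b::comm_ring_1)"
  by (simp add: det_2)

lemma map_matrix_mat2: "map_matrix f (mat2 a b c d) = mat2 (f a) (f b) (f c) (f d)"
  by (simp add: vec_eq_iff forall_2)

lemma map_matrix_poly_fls_mult:
  "map_matrix poly_fls ((A :: 'a::field poly^2^2) ** (B :: 'a poly^2^2)) = map_matrix poly_fls A ** map_matrix poly_fls B"
  by (cases A rule: mat2_cases, cases B rule: mat2_cases)
     (simp add: mat2_mult map_matrix_mat2 poly_fls_add poly_fls_mult)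

lemma det_map_matrix_poly_fls: "det (map_matrix poly_fls A) = poly_fls (det (A :: 'a::field poly^2^2))"
  by (cases A rule: mat2_cases) (simp add: map_matrix_mat2 det_mat2 poly_fls_diff poly_fls_mult)

lemma invertible_mat2_iff: "invertible (\<gamma> :: 'b::comm_ring_1^2^2) \<longleftrightarrow> det \<gamma> dvd 1"
proof
  assume "invertible \<gamma>"
  then obtain \<gamma>' where "\<gamma> ** \<gamma>' = mat 1" by (auto simp: invertible_def)
  then have "det \<gamma> * det \<gamma>' = 1" by (metis det_I det_mul)
  then show "det \<gamma> dvd 1" by (metis dvd_triv_left)
next
  assume "det \<gamma> dvd 1"
  then obtain e where e: "1 = det \<gamma> * e" ..
  obtain a b c d where \<gamma>: "\<gamma> = mat2 a b c d" by (rule mat2_cases)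
  have one: "(mat 1 :: 'b^2^2) = mat2 1 0 0 1"
    by (simp add: vec_eq_iff forall_2 mat_def)
  have "a * (e * d) - b * (e * c) = 1" using e by (simp add: \<gamma> det_mat2 algebra_simps)
  then have "\<gamma> ** mat2 (e * d) (- (e * b)) (- (e * c)) (e * a) = mat 1"
    and "mat2 (e * d) (- (e * b)) (- (e * c)) (e * a) ** \<gamma> = mat 1"
    by (simp_all add: \<gamma> mat2_mult one mat2_eq_iff algebra_simps)
  then show "invertible \<gamma>" unfolding invertible_def by blast
qed

lemma GL2_iff: "\<gamma> \<in> GL2 \<longleftrightarrow> det \<gamma> dvd 1"
  by (simp add: GL2_def invertible_mat2_iff)

lemma Gamma0_mat2: "mat2 a b c d \<in> Gamma0 P \<longleftrightarrow> a * d - b * c dvd 1 \<and> P dvd c"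
  by (simp add: Gamma0_def GL2_iff det_mat2)

text \<open>This makes \<open>GL\<^sub>2(\<O>)\<close> an instance of the computation of translation lattices below.\<close>
lemma Gamma0_1: "Gamma0 1 = GL2"
  by (simp add: Gamma0_def)

lemma Gamma0_subset_GL2: "Gamma0 P \<subseteq> GL2"
  by (auto simp: Gamma0_def)

lemma det_GL2_nonzero: "\<gamma> \<in> GL2 \<Longrightarrow> det \<gamma> \<noteq> 0"
  by (auto simp: GL2_iff)

text \<open>
  With \<open>D\<close> the determinant of \<open>\<gamma> = (a, b; c, d)\<close>, the lower left entry of
  \<open>\<gamma> (1, \<beta>; 0, 1) \<gamma>\<^sup>-\<^sup>1\<close> is \<open>-c\<^sup>2 \<beta> / D\<close>, and \<open>D\<close> is a unit. For irreducible \<open>P\<close> the lattice is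
  thus \<open>\<O>\<close> at the cusps with \<open>P | c\<close> and \<open>P\<O>\<close> at the others.
\<close>
lemma translation_lattice_Gamma0:
  fixes a b c d :: "'a::field poly"
  assumes "mat2 a b c d \<in> GL2"
  shows "translation_lattice (Gamma0 P) (mat2 a b c d) = {\<beta>. P dvd c ^ 2 * \<beta>}"
proof (intro equalityI subsetI CollectI)
  fix \<beta> assume "\<beta> \<in> translation_lattice (Gamma0 P) (mat2 a b c d)"
  then obtain g where g: "g \<in> Gamma0 P" "mat2 a b c d ** mat2 1 \<beta> 0 1 = g ** mat2 a b c d"
    by (auto simp: translation_lattice_def)
  obtain x y u v where gm: "g = mat2 x y u v" by (rule mat2_cases)
  from g have P: "P dvd u" and eq: "u * a + v * c = c" "u * b + v * d = c * \<beta> + d"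
    by (auto simp: gm Gamma0_mat2 mat2_mult mat2_eq_iff)
  have "c ^ 2 * \<beta> = c * (c * \<beta> + d) - c * d" by (simp add: power2_eq_square algebra_simps)
  also have "\<dots> = c * (u * b + v * d) - (u * a + v * c) * d" by (simp only: eq)
  also have "\<dots> = u * (b * c - a * d)" by (simp add: algebra_simps)
  finally show "P dvd c ^ 2 * \<beta>" using P by simp
next
  fix \<beta> assume "\<beta> \<in> {\<beta>. P dvd c ^ 2 * \<beta>}"
  then have P: "P dvd c ^ 2 * \<beta>" by simp
  from assms obtain e where e: "1 = (a * d - b * c) * e" by (auto simp: GL2_iff det_mat2 elim!: dvdE)
  \<comment> \<open>This is \<open>\<gamma> (1, \<beta>; 0, 1) \<gamma>\<^sup>-\<^sup>1\<close>, where \<open>e\<close> is the inverse of the determinant of \<open>\<gamma>\<close>.\<close>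
  let ?g = "mat2 (1 - e * a * c * \<beta>) (e * a * a * \<beta>) (- e * (c ^ 2 * \<beta>)) (1 + e * a * c * \<beta>)"
  have "?g \<in> Gamma0 P"
    unfolding Gamma0_mat2
  proof
    show "P dvd - e * (c ^ 2 * \<beta>)" using P by (rule dvd_mult)
  qed (simp add: power2_eq_square algebra_simps)
  moreover have "x * ((a * d - b * c) * e) = x" for x by (simp flip: e)
  from this[of "a * \<beta>"] this[of "c * \<beta>"]
  have "mat2 a b c d ** mat2 1 \<beta> 0 1 = ?g ** mat2 a b c d"
    by (simp add: mat2_mult mat2_eq_iff power2_eq_square algebra_simps)
  ultimately show "\<beta> \<in> translation_lattice (Gamma0 P) (mat2 a b c d)"
    unfolding translation_lattice_def by blast
qed

lemma translation_lattice_GL2: "\<gamma> \<in> GL2 \<Longrightarrow> translation_lattice GL2 (\<gamma> :: 'a::field poly^2^2) = UNIV"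
  using translation_lattice_Gamma0[where P = 1]
  by (cases \<gamma> rule: mat2_cases) (simp add: Gamma0_1)

text \<open>
  The coset of a matrix is determined by its lower row up to scaling modulo \<open>P\<close>; if \<open>P\<close> does not divide
  \<open>c\<close>, this row can be scaled to \<open>(1, Q)\<close> with \<open>c Q \<equiv> d\<close>, which is the lower row of \<open>S T\<^sub>Q\<close>.
\<close>
lemma Gamma0_coset_decomposition:
  fixes P :: "'a::{finite,field} poly"
  assumes P: "irreducible P" and \<gamma>: "mat2 a b c d \<in> GL2" and c: "\<not> P dvd c"
  obtains g Q where "g \<in> Gamma0 P" "mat2 a b c d = g ** mat2 0 (- 1) 1 Q"
proof -
  obtain x where "P dvd c * x - 1" using inverse_mod_irreducible[OF P c] .
  then have "P dvd c * (x * d) - d"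
    using dvd_mult2[of P "c * x - 1" d] by (simp add: algebra_simps)
  then have "mat2 (a * (x * d) - b) a (c * (x * d) - d) c \<in> Gamma0 P"
    using \<gamma> by (simp add: Gamma0_mat2 GL2_iff det_mat2 algebra_simps)
  moreover have "mat2 a b c d = mat2 (a * (x * d) - b) a (c * (x * d) - d) c ** mat2 0 (- 1) 1 (x * d)"
    by (simp add: mat2_mult mat2_eq_iff)
  ultimately show ?thesis by (rule that)
qed

section \<open>The slash action\<close>

context C_infinity
begin

text \<open>A zero of \<open>x z + y\<close> would be \<open>-y/x\<close>, an element of \<open>K\<^sub>\<infinity>\<close>.\<close>
lemma affine_nonzero:
  assumes "z \<in> Omega \<iota>" "x \<noteq> 0 \<or> y \<noteq> 0"
  shows "\<iota> x * z + \<iota> y \<noteq> 0"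
proof
  assume *: "\<iota> x * z + \<iota> y = 0"
  show False
  proof (cases "x = 0")
    case False
    with * have "z = \<iota> (- y / x)"
      by (simp add: iota_divide iota_uminus field_simps eq_neg_iff_add_eq_0)
    with assms(1) show False by (simp add: Omega_def)
  qed (use * assms(2) in simp)
qed

lemma moebius_denominator_nonzero:
  fixes \<gamma> :: "'a fls^2^2"
  assumes "z \<in> Omega \<iota>" "det \<gamma> \<noteq> 0"
  shows "\<iota> (\<gamma>$2$1) * z + \<iota> (\<gamma>$2$2) \<noteq> 0"
  using assms by (intro affine_nonzero) (auto simp: det_2)

lemma moebius_in_Omega:
  fixes \<gamma> :: "'a fls^2^2"
  assumes z: "z \<in> Omega \<iota>" and det: "det \<gamma> \<noteq> 0"
  shows "moebius \<iota> \<gamma> z \<in> Omega \<iota>"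
proof -
  have "moebius \<iota> \<gamma> z \<noteq> \<iota> x" for x
  proof
    assume "moebius \<iota> \<gamma> z = \<iota> x"
    then have "\<iota> (\<gamma>$1$1) * z + \<iota> (\<gamma>$1$2) = \<iota> x * (\<iota> (\<gamma>$2$1) * z + \<iota> (\<gamma>$2$2))"
      using moebius_denominator_nonzero[OF z det] by (simp add: moebius_def field_simps)
    then have "\<iota> (\<gamma>$1$1 - x * \<gamma>$2$1) * z + \<iota> (\<gamma>$1$2 - x * \<gamma>$2$2) = 0"
      by (simp add: iota_diff hom_mult algebra_simps)
    then have "\<gamma>$1$1 - x * \<gamma>$2$1 = 0" "\<gamma>$1$2 - x * \<gamma>$2$2 = 0"
      using affine_nonzero[OF z] by blast+
    with det show False by (simp add: det_2 algebra_simps)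
  qed
  then show ?thesis by (auto simp: Omega_def)
qed

text \<open>
  The cocycle relation \<open>j(A B, z) = j(A, B z) j(B, z)\<close> for \<open>j(\<gamma>, z) = c z + d\<close>, which holds because
  \<open>\<gamma> (z, 1)\<^sup>T = j(\<gamma>, z) (\<gamma> z, 1)\<^sup>T\<close>.
\<close>
lemma slash_slash:
  assumes A: "det A \<noteq> 0" and B: "det B \<noteq> 0"
  shows "slash \<iota> k m (slash \<iota> k m \<phi> A) B = slash \<iota> k m \<phi> (A ** B)"
proof
  fix z
  show "slash \<iota> k m (slash \<iota> k m \<phi> A) B z = slash \<iota> k m \<phi> (A ** B) z"
  proof (cases "z \<in> Omega \<iota>")
    case z: True
    obtain a b c d where Am: "A = mat2 a b c d" by (rule mat2_cases)
    obtain a' b' c' d' where Bm: "B = mat2 a' b' c' d'" by (rule mat2_cases)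
    define j where "j = \<iota> c' * z + \<iota> d'"
    define w where "w = moebius \<iota> B z"
    have w: "w \<in> Omega \<iota>" unfolding w_def by (rule moebius_in_Omega[OF z B])
    have j: "j \<noteq> 0" using moebius_denominator_nonzero[OF z B] by (simp add: j_def Bm)
    have wj: "w * j = \<iota> a' * z + \<iota> b'" using j by (simp add: w_def moebius_def Bm j_def)
    have lin: "(\<iota> x * w + \<iota> y) * j = \<iota> (x * a' + y * c') * z + \<iota> (x * b' + y * d')" for x y
    proof -
      have "(\<iota> x * w + \<iota> y) * j = \<iota> x * (w * j) + \<iota> y * j" by (simp add: algebra_simps)
      then show ?thesis unfolding wj by (simp add: j_def hom_add hom_mult algebra_simps)
    qed
    have "moebius \<iota> (A ** B) z = moebius \<iota> A w"
      using j by (simp add: moebius_def Am Bm mat2_mult flip: lin)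
    then show ?thesis using z w
      by (simp add: slash_def w_def[symmetric] det_mul hom_mult power_int_mult_distrib)
         (simp add: Am Bm mat2_mult power_int_mult_distrib j_def[symmetric] flip: lin)
  qed (simp add: slash_def)
qed

lemma pslash_pslash:
  assumes "det A \<noteq> 0" "det B \<noteq> 0"
  shows "pslash \<iota> k m (pslash \<iota> k m \<phi> A) B = pslash \<iota> k m \<phi> (A ** B)"
  using assms by (simp add: slash_slash map_matrix_poly_fls_mult det_map_matrix_poly_fls)

lemma pslash_mat2:
  "pslash \<iota> k m \<phi> (mat2 a b c d) = (\<lambda>z. if z \<in> Omega \<iota>
     then \<phi> ((cpoly \<iota> a * z + cpoly \<iota> b) / (cpoly \<iota> c * z + cpoly \<iota> d)) *
       cpoly \<iota> (a * d - b * c) powi m * (cpoly \<iota> c * z + cpoly \<iota> d) powi (- k) else 0)"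
  by (simp add: slash_def moebius_def map_matrix_mat2 det_mat2 poly_fls_diff poly_fls_mult fun_eq_iff)

lemma slash_cmult: "slash \<iota> k m (\<lambda>z. c * \<phi> z) \<gamma> = (\<lambda>z. c * slash \<iota> k m \<phi> \<gamma> z)"
  by (simp add: slash_def fun_eq_iff)

lemma slash_sum_eq_0:
  assumes "\<And>z. (\<Sum>i\<in>I. \<phi> i z) = 0"
  shows "(\<Sum>i\<in>I. slash \<iota> k m (\<phi> i) \<gamma> z) = 0"
  using assms by (cases "z \<in> Omega \<iota>") (simp_all add: slash_def flip: sum_distrib_right)

section \<open>Modular forms with vanishing trace\<close>

text \<open>
  The hypothesis says that the cosets other than \<open>\<Gamma>\<^sub>0(P)\<close> contribute nothing to the trace of \<open>\<psi>\<close>. It is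
  enough to show \<open>\<psi>|S = \<psi>\<close>, because every matrix outside \<open>\<Gamma>\<^sub>0(P)\<close> is of the form \<open>g S T\<^sub>Q\<close> with
  \<open>g \<in> \<Gamma>\<^sub>0(P)\<close>. Right multiplication by \<open>S\<close> exchanges the cosets of \<open>1\<close> and \<open>S\<close>, and sends the coset of
  \<open>S T\<^sub>Q\<close> for \<open>Q \<noteq> 0\<close> to that of \<open>S T\<^sub>Q\<^sub>'\<close> with \<open>Q Q' \<equiv> -1\<close> modulo \<open>P\<close>. Applying \<open>S\<close> to the vanishing sum
  therefore gives the same sum with \<open>\<psi>|S\<close> replaced by \<open>\<psi>\<close>.
\<close>
theorem GL2_invariant_if_trace_vanishes:
  fixes P :: "'a poly"
  assumes P: "irreducible P"
    and inv: "\<And>\<gamma>. \<gamma> \<in> Gamma0 P \<Longrightarrow> pslash \<iota> k m \<psi> \<gamma> = \<psi>"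
    and sum: "\<And>z. (\<Sum>Q | degree Q < degree P. pslash \<iota> k m \<psi> (mat2 0 (- 1) 1 Q) z) = 0"
    and \<gamma>: "\<gamma> \<in> GL2"
  shows "pslash \<iota> k m \<psi> \<gamma> = \<psi>"
proof -
  have prime: "prime_elem P" using P by (rule field_poly_irreducible_imp_prime)
  have P0: "P \<noteq> 0" using P by auto
  have deg: "degree P > 0" using P by (rule irreducible_poly_degree_pos)
  define F where "F \<gamma> = pslash \<iota> k m \<psi> \<gamma>" for \<gamma>
  have F_mult: "F (g ** M) = F M" if "g \<in> Gamma0 P" "det M \<noteq> 0" for g M
    using pslash_pslash[of g M k m \<psi>] that Gamma0_subset_GL2[of P] inv[OF that(1)]
    by (auto simp: F_def det_GL2_nonzero subset_iff)
  define R where "R = {Q :: 'a poly. degree Q < degree P \<and> Q \<noteq> 0}"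
  have ndvd: "\<not> P dvd Q" if "Q \<in> R" for Q
    using that dvd_imp_degree[of P Q] P0 by (auto simp: R_def)
  have "\<exists>Q'\<in>R. P dvd Q * Q' + 1" if Q: "Q \<in> R" for Q
  proof -
    obtain x where x: "P dvd Q * x - 1" using inverse_mod_irreducible[OF P ndvd[OF Q]] .
    have "P dvd Q * (- x mod P) + 1"
    proof -
      have "Q * (- x mod P) + 1 = - (Q * x - 1) - Q * (P * (- x div P))"
        by (simp add: minus_div_mult_eq_mod[symmetric] algebra_simps)
      moreover have "P dvd - (Q * x - 1) - Q * (P * (- x div P))"
        using x by (intro dvd_diff) (simp_all only: dvd_minus_iff dvd_mult dvd_triv_left)
      ultimately show ?thesis by (simp only:)
    qed
    moreover have "- x mod P \<in> R"
    proof -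
      have "- x mod P \<noteq> 0"
        using calculation P by (auto simp: irreducible_def)
      then show ?thesis using degree_mod_less[OF P0, of "- x"] by (auto simp: R_def)
    qed
    ultimately show ?thesis by blast
  qed
  then obtain \<sigma> where \<sigma>: "\<And>Q. Q \<in> R \<Longrightarrow> \<sigma> Q \<in> R" "\<And>Q. Q \<in> R \<Longrightarrow> P dvd Q * \<sigma> Q + 1"
    by metis
  have \<sigma>\<sigma>: "\<sigma> (\<sigma> Q) = Q" if Q: "Q \<in> R" for Q
  proof -
    have "\<sigma> Q * (Q - \<sigma> (\<sigma> Q)) = (Q * \<sigma> Q + 1) - (\<sigma> Q * \<sigma> (\<sigma> Q) + 1)"
      by (simp add: algebra_simps)
    then have "P dvd \<sigma> Q * (Q - \<sigma> (\<sigma> Q))" using \<sigma> Q by (metis dvd_diff)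
    then have "P dvd Q - \<sigma> (\<sigma> Q)"
      using prime ndvd[OF \<sigma>(1)[OF Q]] by (auto simp: prime_elem_dvd_mult_iff)
    moreover have "degree (Q - \<sigma> (\<sigma> Q)) < degree P"
      using Q \<sigma>(1)[OF Q] \<sigma>(1)[OF \<sigma>(1)[OF Q]] by (auto simp: R_def intro: degree_diff_less)
    ultimately show ?thesis using dvd_imp_degree[of P "Q - \<sigma> (\<sigma> Q)"] P0 by fastforce
  qed
  have split: "(\<Sum>Q | degree Q < degree P. f Q) = f 0 + (\<Sum>Q\<in>R. f Q)" for f :: "'a poly \<Rightarrow> 'c"
  proof -
    have "finite {Q :: 'a poly. degree Q < degree P}" using deg by (simp add: residues_eq_deg_le)
    moreover have "{Q. degree Q < degree P} - {0} = R" by (auto simp: R_def)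
    ultimately show ?thesis using deg by (subst sum.remove[of _ 0]) auto
  qed
  have S: "F (mat2 0 (- 1) 1 0) = \<psi>"
  proof
    fix z
    have swap: "F (mat2 (- 1) 0 Q (- 1)) = F (mat2 0 (- 1) 1 (\<sigma> Q))" if "Q \<in> R" for Q
    proof -
      \<comment> \<open>The matrix is \<open>S T\<^sub>Q S (S T\<^sub>\<sigma>\<^sub>Q)\<^sup>-\<^sup>1\<close>.\<close>
      have "mat2 (- \<sigma> Q) (- 1) (Q * \<sigma> Q + 1) Q \<in> Gamma0 P"
        using \<sigma>(2)[OF that] by (simp add: Gamma0_mat2 algebra_simps)
      moreover have "mat2 (- \<sigma> Q) (- 1) (Q * \<sigma> Q + 1) Q ** mat2 0 (- 1) 1 (\<sigma> Q) = mat2 (- 1) 0 Q (- 1)"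
        by (simp add: mat2_mult mat2_eq_iff algebra_simps)
      ultimately show ?thesis
        using F_mult[of "mat2 (- \<sigma> Q) (- 1) (Q * \<sigma> Q + 1) Q" "mat2 0 (- 1) 1 (\<sigma> Q)"]
        by (simp add: det_mat2)
    qed
    have "(\<Sum>Q | degree Q < degree P. F (mat2 (- 1) 0 Q (- 1)) z) =
        (\<Sum>Q | degree Q < degree P. pslash \<iota> k m (F (mat2 0 (- 1) 1 Q)) (mat2 0 (- 1) 1 0) z)"
      unfolding F_def by (subst pslash_pslash) (simp_all add: det_mat2 mat2_mult)
    also have "\<dots> = 0" unfolding F_def by (rule slash_sum_eq_0[OF sum])
    finally have "F (mat2 (- 1) 0 0 (- 1)) z + (\<Sum>Q\<in>R. F (mat2 (- 1) 0 Q (- 1)) z) = 0"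
      by (simp add: split)
    moreover have "F (mat2 (- 1) 0 0 (- 1)) = \<psi>"
      unfolding F_def by (rule inv) (simp add: Gamma0_mat2)
    moreover have "(\<Sum>Q\<in>R. F (mat2 (- 1) 0 Q (- 1)) z) = (\<Sum>Q\<in>R. F (mat2 0 (- 1) 1 Q) z)"
      by (rule sum.reindex_bij_witness[of _ \<sigma> \<sigma>]) (auto simp: \<sigma> \<sigma>\<sigma> swap)
    moreover have "F (mat2 0 (- 1) 1 0) z + (\<Sum>Q\<in>R. F (mat2 0 (- 1) 1 Q) z) = 0"
      using sum[of z] by (simp add: F_def split)
    ultimately show "F (mat2 0 (- 1) 1 0) z = \<psi> z"
      by (metis add_right_imp_eq)
  qed
  obtain a b c d where \<gamma>m: "\<gamma> = mat2 a b c d" by (rule mat2_cases)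
  have "F \<gamma> = \<psi>"
  proof (cases "P dvd c")
    case True
    then have "\<gamma> \<in> Gamma0 P" using \<gamma> by (simp add: \<gamma>m Gamma0_mat2 GL2_iff det_mat2)
    then show ?thesis by (simp add: F_def inv)
  next
    case False
    then obtain g Q where g: "g \<in> Gamma0 P" "\<gamma> = g ** mat2 0 (- 1) 1 Q"
      using Gamma0_coset_decomposition[OF P] \<gamma> unfolding \<gamma>m by metis
    have "F \<gamma> = F (mat2 0 (- 1) 1 Q)" unfolding g(2) by (rule F_mult[OF g(1)]) (simp add: det_mat2)
    also have "\<dots> = pslash \<iota> k m (F (mat2 0 (- 1) 1 0)) (mat2 1 Q 0 1)"
      unfolding F_def by (subst pslash_pslash) (simp_all add: det_mat2 mat2_mult)
    also have "\<dots> = \<psi>" unfolding S by (rule inv) (simp add: Gamma0_mat2)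
    finally show ?thesis .
  qed
  then show ?thesis by (simp add: F_def)
qed

end

section \<open>Analyticity and cusp expansions under affine substitutions\<close>

context C_infinity
begin

lemma scale_Omega:
  assumes "x \<noteq> 0"
  shows "\<iota> x * z \<in> Omega \<iota> \<longleftrightarrow> z \<in> Omega \<iota>"
proof -
  have "\<iota> x * z = \<iota> y \<longleftrightarrow> z = \<iota> (y / x)" for y
    using assms by (auto simp: iota_divide field_simps)
  moreover have "\<iota> x * \<iota> y = \<iota> (x * y)" for y by (simp add: hom_mult)
  ultimately show ?thesis unfolding Omega_def by (metis ComplD ComplI rangeE rangeI)
qed

text \<open>
  The scaling maps the affinoid \<open>\<Omega>\<^sub>n\<close> into \<open>\<Omega>\<^sub>n\<^sub>+\<^sub>N\<close> as soon as \<open>q\<^sup>N\<close> exceeds \<open>|x|\<close> and \<open>1/|x|\<close>, since it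
  permutes \<open>K\<^sub>\<infinity>\<close>; approximating rational functions are pulled back along it.
\<close>
lemma rigid_analytic_scale:
  assumes f: "rigid_analytic \<iota> f" and x: "x \<noteq> 0"
  shows "rigid_analytic \<iota> (\<lambda>z. c * f (\<iota> x * z))"
  unfolding rigid_analytic_def
proof (intro conjI allI impI)
  show "c * f (\<iota> x * z) = 0" if "z \<notin> Omega \<iota>" for z
    using that f x by (simp add: rigid_analytic_def scale_Omega)
next
  fix n and \<epsilon> :: real assume "\<epsilon> > 0"
  let ?q = "real CARD('a)" and ?x = "dist (\<iota> x) 0"
  have x0: "?x > 0" using x by simp
  obtain N where N: "max ?x (1 / ?x) < ?q ^ N"
    using real_arch_pow[OF CARD_gt_1] by blast
  have q0: "?q ^ j > 0" for j using CARD_gt_1 by simp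
  have into: "\<iota> x * z \<in> Omega_affinoid \<iota> (n + N)" if z: "z \<in> Omega_affinoid \<iota> n" for z
    unfolding Omega_affinoid_def
  proof (intro CollectI conjI allI)
    have "?x * dist z 0 \<le> ?q ^ N * ?q ^ n"
      using z N q0 by (intro mult_mono) (auto simp: Omega_affinoid_def)
    then show "dist (\<iota> x * z) 0 \<le> ?q ^ (n + N)"
      by (simp add: abs_mult power_add mult.commute)
    fix y
    have "\<iota> x * z - \<iota> y = \<iota> x * (z - \<iota> (y / x))"
      using x by (simp add: iota_divide field_simps)
    then have "dist (\<iota> x * z) (\<iota> y) = ?x * dist z (\<iota> (y / x))"
      by (metis abs_mult dist_diff)
    moreover have "1 / ?q ^ N * (1 / ?q ^ n) \<le> ?x * dist z (\<iota> (y / x))"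
    proof (rule mult_mono)
      show "1 / ?q ^ N \<le> ?x" using N x0 q0[of N] by (simp add: field_simps)
      show "1 / ?q ^ n \<le> dist z (\<iota> (y / x))" using z by (auto simp: Omega_affinoid_def)
    qed auto
    ultimately show "1 / ?q ^ (n + N) \<le> dist (\<iota> x * z) (\<iota> y)"
      by (simp add: power_add mult.commute)
  qed
  have "\<epsilon> / (dist c 0 + 1) > 0" using \<open>\<epsilon> > 0\<close> by (simp add: add_nonneg_pos)
  then obtain g h where gh: "\<And>z. z \<in> Omega_affinoid \<iota> (n + N) \<Longrightarrow>
      poly h z \<noteq> 0 \<and> dist (f z) (poly g z / poly h z) < \<epsilon> / (dist c 0 + 1)"
    using f unfolding rigid_analytic_def by blast
  show "\<exists>g h. \<forall>z\<in>Omega_affinoid \<iota> n. poly h z \<noteq> 0 \<and>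
      dist (c * f (\<iota> x * z)) (poly g z / poly h z) < \<epsilon>"
  proof (intro exI ballI conjI)
    fix z assume "z \<in> Omega_affinoid \<iota> n"
    note * = gh[OF into[OF this]]
    show "poly (pcompose h [:0, \<iota> x:]) z \<noteq> 0"
      using * by (simp add: poly_pcompose mult.commute)
    have "dist (c * f (\<iota> x * z)) (c * (poly g (\<iota> x * z) / poly h (\<iota> x * z))) =
        dist c 0 * dist (f (\<iota> x * z)) (poly g (\<iota> x * z) / poly h (\<iota> x * z))"
      by (metis abs_mult dist_diff right_diff_distrib)
    also have "\<dots> \<le> dist c 0 * (\<epsilon> / (dist c 0 + 1))"
      using * by (intro mult_left_mono) auto
    also have "\<dots> < \<epsilon>"
    proof -
      have "dist c 0 + 1 > 0" by (simp add: add_nonneg_pos)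
      with \<open>\<epsilon> > 0\<close> show ?thesis by (simp add: pos_divide_less_eq algebra_simps)
    qed
    finally show "dist (c * f (\<iota> x * z))
        (poly (smult c (pcompose g [:0, \<iota> x:])) z / poly (pcompose h [:0, \<iota> x:]) z) < \<epsilon>"
      by (simp add: poly_pcompose mult.commute)
  qed
qed

definition vanishes_at_infinity :: "'a poly set \<Rightarrow> ('c \<Rightarrow> 'c) \<Rightarrow> bool" where
  "vanishes_at_infinity \<Lambda> f \<longleftrightarrow> (\<exists>a. has_cusp_expansion \<iota> \<Lambda> f a \<and> a 0 = 0)"

text \<open>
  The constant \<open>c\<close> allows for expansions in a multiple of the parameter, as the substitutions below
  change the parameter by such factors.
\<close>
lemma vanishes_at_infinityI:
  assumes "s > 0" "b 0 = 0"
    "\<And>z. z \<in> Omega \<iota> \<Longrightarrow> dist (c * cusp_param \<iota> \<Lambda> z) 0 < s \<Longrightarrow>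
      (\<lambda>n. b n * (c * cusp_param \<iota> \<Lambda> z) ^ n) sums f z"
    and "c \<noteq> 0"
  shows "vanishes_at_infinity \<Lambda> f"
proof -
  have "has_cusp_expansion \<iota> \<Lambda> f (\<lambda>n. b n * c ^ n)"
    unfolding has_cusp_expansion_def
  proof (intro exI[of _ "s / dist c 0"] conjI ballI impI)
    show "s / dist c 0 > 0" using assms by simp
    fix z assume z: "z \<in> Omega \<iota>" "dist (cusp_param \<iota> \<Lambda> z) 0 < s / dist c 0"
    then have "dist (c * cusp_param \<iota> \<Lambda> z) 0 < s"
      using \<open>c \<noteq> 0\<close> by (simp add: abs_mult field_simps)
    from assms(3)[OF z(1) this]
    show "(\<lambda>n. b n * c ^ n * cusp_param \<iota> \<Lambda> z ^ n) sums f z"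
      by (simp add: power_mult_distrib mult.assoc)
  qed
  then show ?thesis using assms(2) by (auto simp: vanishes_at_infinity_def)
qed

lemma vanishes_at_infinityE:
  assumes "vanishes_at_infinity \<Lambda> f"
  obtains r a where "r > 0" "a 0 = 0"
    "\<And>z. z \<in> Omega \<iota> \<Longrightarrow> dist (cusp_param \<iota> \<Lambda> z) 0 < r \<Longrightarrow>
      (\<lambda>n. a n * cusp_param \<iota> \<Lambda> z ^ n) sums f z"
  using assms unfolding vanishes_at_infinity_def has_cusp_expansion_def by blast

lemma vanishes_at_infinity_cmult:
  assumes "vanishes_at_infinity \<Lambda> f" "\<And>z. z \<in> Omega \<iota> \<Longrightarrow> g z = c * f z"
  shows "vanishes_at_infinity \<Lambda> g"
proof -
  from assms(1) obtain r a where ra: "r > 0" "a 0 = 0"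
    "\<And>z. z \<in> Omega \<iota> \<Longrightarrow> dist (cusp_param \<iota> \<Lambda> z) 0 < r \<Longrightarrow>
      (\<lambda>n. a n * cusp_param \<iota> \<Lambda> z ^ n) sums f z" by (rule vanishes_at_infinityE) blast
  show ?thesis
  proof (rule vanishes_at_infinityI[where s = r and b = "\<lambda>n. c * a n" and c = 1])
    fix z assume z: "z \<in> Omega \<iota>" "dist (1 * cusp_param \<iota> \<Lambda> z) 0 < r"
    then have "(\<lambda>n. a n * cusp_param \<iota> \<Lambda> z ^ n) sums f z" by (intro ra(3)) auto
    from tendsto_cmult_C[OF this[unfolded sums_def], of c]
    show "(\<lambda>n. c * a n * (1 * cusp_param \<iota> \<Lambda> z) ^ n) sums g z"
      using assms(2)[OF z(1)] by (simp add: sums_def sum_distrib_left mult.assoc)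
  qed (use ra in auto)
qed

lemma scale_poly_Omega: "P \<noteq> 0 \<Longrightarrow> cpoly \<iota> P * z \<in> Omega \<iota> \<longleftrightarrow> z \<in> Omega \<iota>"
  by (simp add: scale_Omega)

lemma vanishes_at_infinity_scale_multiples:
  assumes f: "vanishes_at_infinity {l. P dvd l} f" and P: "P \<noteq> 0"
  shows "vanishes_at_infinity UNIV (\<lambda>z. f (cpoly \<iota> P * z))"
proof -
  have u: "cusp_param \<iota> {l. P dvd l} (cpoly \<iota> P * z) = 1 / cpoly \<iota> P * cusp_param \<iota> UNIV z" for z
    by (simp add: cusp_param_def exp_multiples[OF P])
  from f obtain r a where ra: "r > 0" "a 0 = 0"
    "\<And>z. z \<in> Omega \<iota> \<Longrightarrow> dist (cusp_param \<iota> {l. P dvd l} z) 0 < r \<Longrightarrow>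
      (\<lambda>n. a n * cusp_param \<iota> {l. P dvd l} z ^ n) sums f z" by (rule vanishes_at_infinityE) blast
  show ?thesis
  proof (rule vanishes_at_infinityI[where s = r and b = a and c = "1 / cpoly \<iota> P"])
    fix z assume "z \<in> Omega \<iota>" "dist (1 / cpoly \<iota> P * cusp_param \<iota> UNIV z) 0 < r"
    then show "(\<lambda>n. a n * (1 / cpoly \<iota> P * cusp_param \<iota> UNIV z) ^ n) sums f (cpoly \<iota> P * z)"
      unfolding u[symmetric] using P by (intro ra(3)) (simp_all add: scale_poly_Omega)
  qed (use ra P in auto)
qed

lemma Omega_exp_nonzero: "z \<in> Omega \<iota> \<Longrightarrow> exp_lattice \<iota> UNIV z \<noteq> 0"
  by (intro exp_UNIV_nonzero) (auto simp: Omega_def)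

text \<open>The factor \<open>1 / (e - w)\<close> in terms of \<open>u = 1/e\<close>; for \<open>e = w\<close> both sides are \<open>0\<close>, as \<open>1 / 0 = 0\<close>.\<close>
lemma cusp_param_shift:
  assumes "exp_lattice \<iota> UNIV z \<noteq> 0"
  shows "1 / (exp_lattice \<iota> UNIV z - w) = cusp_param \<iota> UNIV z / (1 - w * cusp_param \<iota> UNIV z)"
proof (cases "exp_lattice \<iota> UNIV z = w")
  case False
  then show ?thesis using assms by (simp add: cusp_param_def field_simps)
qed (use assms in \<open>simp add: cusp_param_def\<close>)

text \<open>
  By additivity, the parameter at \<open>(z + Q)/P\<close> is \<open>1 / (e(z/P) + e(Q/P))\<close>, while \<open>1 / e(z/P)\<close> is \<open>P\<close> times the
  parameter of \<open>P\<O>\<close> at \<open>z\<close>.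
\<close>
lemma vanishes_at_infinity_affine:
  assumes f: "vanishes_at_infinity UNIV f" and P: "P \<noteq> 0"
  shows "vanishes_at_infinity {l. P dvd l} (\<lambda>z. f ((z + cpoly \<iota> Q) / cpoly \<iota> P))"
proof -
  define p where "p = cpoly \<iota> P"
  have p: "p \<noteq> 0" using P by (simp add: p_def)
  define w where "w = - exp_lattice \<iota> UNIV (cpoly \<iota> Q / p)"
  define u where "u z = p * cusp_param \<iota> {l. P dvd l} z" for z
  have u: "u z = cusp_param \<iota> UNIV (z / p)" for z
    using exp_multiples[OF P, of "z / p"] p by (simp add: u_def cusp_param_def p_def)
  from f obtain r a where ra: "r > 0" "a 0 = 0"
    "\<And>z. z \<in> Omega \<iota> \<Longrightarrow> dist (cusp_param \<iota> UNIV z) 0 < r \<Longrightarrow>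
      (\<lambda>n. a n * cusp_param \<iota> UNIV z ^ n) sums f z" by (rule vanishes_at_infinityE) blast
  have Omega1: "z / p \<in> Omega \<iota>" if "z \<in> Omega \<iota>" for z
    using scale_poly_Omega[OF P, of "z / p"] that p by (simp add: p_def)
  have Omega2: "(z + cpoly \<iota> Q) / p \<in> Omega \<iota>" if "z \<in> Omega \<iota>" for z
  proof (rule ccontr)
    assume "(z + cpoly \<iota> Q) / p \<notin> Omega \<iota>"
    then obtain y where "(z + cpoly \<iota> Q) / p = \<iota> y" by (auto simp: Omega_def)
    then have "z = \<iota> (poly_fls P * y - poly_fls Q)"
      using p by (simp add: iota_diff hom_mult field_simps p_def)
    with that show False by (simp add: Omega_def)
  qed
  \<comment> \<open>A product with a single factor, which is the form taken by \<open>power_series_substitution\<close>.\<close>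
  have param: "cusp_param \<iota> UNIV ((z + cpoly \<iota> Q) / p) = (\<Prod>i\<in>{()}. u z / (1 - w * u z))"
    if "z \<in> Omega \<iota>" for z
  proof -
    have "cusp_param \<iota> UNIV ((z + cpoly \<iota> Q) / p) = 1 / (exp_lattice \<iota> UNIV (z / p) - w)"
      by (simp add: cusp_param_def add_divide_distrib exp_UNIV_add w_def)
    then show ?thesis
      using cusp_param_shift[OF Omega_exp_nonzero[OF Omega1[OF that]]] by (simp add: u)
  qed
  obtain b s where bs: "s > 0" "b 0 = 0" "\<And>z. z \<in> Omega \<iota> \<Longrightarrow> dist (u z) 0 < s \<Longrightarrow>
      (\<lambda>n. b n * u z ^ n) sums f ((z + cpoly \<iota> Q) / p)"
  proof (rule power_series_substitution[where I = "{()}" and w = "\<lambda>_. w" and u = u and a = a and r = r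
        and S = "Omega \<iota>" and f = "\<lambda>z. f ((z + cpoly \<iota> Q) / p)"])
    fix z assume z: "z \<in> Omega \<iota>" "dist (\<Prod>i\<in>{()}. u z / (1 - w * u z)) 0 < r"
    show "(\<lambda>n. a n * (\<Prod>i\<in>{()}. u z / (1 - w * u z)) ^ n) sums f ((z + cpoly \<iota> Q) / p)"
      using ra(3)[OF Omega2[OF z(1)]] z(2) unfolding param[OF z(1)] by blast
  qed (use ra in auto)
  show ?thesis
    unfolding p_def[symmetric]
    by (rule vanishes_at_infinityI[where s = s and b = b and c = p])
       (use bs p in \<open>auto simp: u_def\<close>)
qed

text \<open>
  By the multiplication formula and additivity, \<open>e(P z) = \<kappa> \<Prod>\<^sub>Q (e(z) - e(Q/P))\<close>. The
  product of the \<open>e(-Q/P)\<close> in the denominator of \<open>\<kappa>\<close> is nonzero because \<open>Q/P\<close> is not in \<open>\<O>\<close> for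
  \<open>Q \<noteq> 0\<close>.
\<close>
lemma vanishes_at_infinity_scale:
  assumes f: "vanishes_at_infinity UNIV f" and P: "degree P > 0"
  shows "vanishes_at_infinity UNIV (\<lambda>z. f (cpoly \<iota> P * z))"
proof -
  have P0: "P \<noteq> 0" using P by auto
  define p where "p = cpoly \<iota> P"
  have p: "p \<noteq> 0" using P0 by (simp add: p_def)
  define R where "R = {Q :: 'a poly. degree Q < degree P}"
  define e where "e = exp_lattice \<iota> UNIV"
  define w where "w Q = e (cpoly \<iota> Q / p)" for Q
  define \<kappa> where "\<kappa> = p / (\<Prod>Q | degree Q < degree P \<and> Q \<noteq> 0. e (- cpoly \<iota> Q / p))"
  let ?u = "cusp_param \<iota> UNIV"
  have "finite R" using P by (simp add: R_def residues_eq_deg_le)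
  moreover have "0 \<in> R" using P by (simp add: R_def)
  ultimately have R: "finite R" "R \<noteq> {}" by auto
  have denom: "(\<Prod>Q | degree Q < degree P \<and> Q \<noteq> 0. e (- cpoly \<iota> Q / p)) \<noteq> 0"
  proof -
    have "e (- cpoly \<iota> Q / p) \<noteq> 0" if "degree Q < degree P" "Q \<noteq> 0" for Q
      unfolding e_def
    proof (rule exp_UNIV_nonzero, rule notI)
      assume "- cpoly \<iota> Q / p \<in> range (cpoly \<iota>)"
      then obtain l where "- cpoly \<iota> Q / p = cpoly \<iota> l" by blast
      then have "- cpoly \<iota> Q = cpoly \<iota> l * p" using p by (simp add: field_simps)
      then have "cpoly \<iota> (- Q) = cpoly \<iota> (l * P)" by (simp add: p_def cpoly_uminus cpoly_mult)
      then have "- Q = l * P" by (simp only: cpoly_eq_iff)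
      then have "P dvd Q" by (metis dvd_minus_iff dvd_triv_right)
      then show False using that dvd_imp_degree[of P Q] P0 by auto
    qed
    moreover have "finite {Q :: 'a poly. degree Q < degree P \<and> Q \<noteq> 0}"
      by (rule finite_subset[OF _ R(1)]) (auto simp: R_def)
    ultimately show ?thesis by (simp add: prod_zero_iff)
  qed
  have \<kappa>: "\<kappa> \<noteq> 0" using denom p by (simp add: \<kappa>_def)
  have param: "(\<Prod>Q\<in>R. ?u z / (1 - w Q * ?u z)) = \<kappa> * ?u (p * z)" if z: "z \<in> Omega \<iota>" for z
  proof -
    have "e (p * z) = \<kappa> * (\<Prod>Q\<in>R. e (z - cpoly \<iota> Q / p))"
      using exp_UNIV_mult[OF P, of z] denom by (simp add: \<kappa>_def e_def p_def R_def field_simps)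
    then have "e (p * z) = \<kappa> * (\<Prod>Q\<in>R. e z - w Q)"
      by (simp add: e_def w_def exp_UNIV_diff)
    then have "\<kappa> * ?u (p * z) = (\<Prod>Q\<in>R. 1 / (e z - w Q))"
      using \<kappa> by (simp add: cusp_param_def e_def prod_dividef)
    then show ?thesis
      using cusp_param_shift[OF Omega_exp_nonzero[OF z]] by (simp add: e_def)
  qed
  from f obtain r a where ra: "r > 0" "a 0 = 0"
    "\<And>z. z \<in> Omega \<iota> \<Longrightarrow> dist (?u z) 0 < r \<Longrightarrow> (\<lambda>n. a n * ?u z ^ n) sums f z"
    by (rule vanishes_at_infinityE) blast
  obtain b s where bs: "s > 0" "b 0 = 0"
    "\<And>z. z \<in> Omega \<iota> \<Longrightarrow> dist (?u z) 0 < s \<Longrightarrow> (\<lambda>n. b n * ?u z ^ n) sums f (p * z)"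
  proof (rule power_series_substitution[where I = R and w = w and u = ?u and S = "Omega \<iota>"
        and a = "\<lambda>n. a n * (1 / \<kappa>) ^ n" and r = "r * dist \<kappa> 0" and f = "\<lambda>z. f (p * z)"])
    fix z assume z: "z \<in> Omega \<iota>" "dist (\<Prod>Q\<in>R. ?u z / (1 - w Q * ?u z)) 0 < r * dist \<kappa> 0"
    then have "dist (?u (p * z)) 0 < r"
      using \<kappa> unfolding param[OF z(1)] by (simp add: abs_mult mult.commute)
    moreover have "p * z \<in> Omega \<iota>" using z P0 by (simp add: p_def scale_poly_Omega)
    ultimately have "(\<lambda>n. a n * ?u (p * z) ^ n) sums f (p * z)" by (rule ra(3)[rotated])
    then show "(\<lambda>n. a n * (1 / \<kappa>) ^ n * (\<Prod>Q\<in>R. ?u z / (1 - w Q * ?u z)) ^ n) sums f (p * z)"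
      unfolding param[OF z(1)] using \<kappa> by (simp add: power_mult_distrib power_divide)
  qed (use ra R \<kappa> in auto)
  show ?thesis
    unfolding p_def[symmetric]
    by (rule vanishes_at_infinityI[where s = s and b = b and c = 1]) (use bs in auto)
qed

section \<open>The kernel of the Atkin operator\<close>

lemma cusp_forms_iff:
  "\<phi> \<in> cusp_forms \<iota> \<Gamma> k m \<longleftrightarrow> rigid_analytic \<iota> \<phi> \<and> (\<forall>\<gamma>\<in>\<Gamma>. pslash \<iota> k m \<phi> \<gamma> = \<phi>) \<and>
     (\<forall>\<gamma>\<in>GL2. vanishes_at_infinity (translation_lattice \<Gamma> \<gamma>) (pslash \<iota> k m \<phi> \<gamma>))"
  by (simp add: cusp_forms_def vanishes_at_infinity_def)

lemma degeneracy_apply: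
  assumes "rigid_analytic \<iota> \<phi>" "P \<noteq> 0"
  shows "degeneracy \<iota> k m P \<phi> = (\<lambda>z. cpoly \<iota> P powi m * \<phi> (cpoly \<iota> P * z))"
  using assms by (auto simp: degeneracy_def pslash_mat2 hom_one fun_eq_iff rigid_analytic_def scale_poly_Omega)

text \<open>
  Invariance holds because \<open>A \<gamma> A\<^sup>-\<^sup>1\<close> is integral for \<open>\<gamma> \<in> \<Gamma>\<^sub>0(P)\<close>. At a cusp, \<open>\<gamma>\<close> is either in \<open>\<Gamma>\<^sub>0(P)\<close>
  or equal to \<open>g S T\<^sub>Q\<close>. In the first case \<open>(\<psi>|A)|\<gamma>\<close> is a multiple of \<open>\<psi>(P z)\<close>, to be expanded for the lattice
  \<open>\<O>\<close>. In the second case \<open>A S T\<^sub>Q = S (1, Q; 0, P)\<close> shows that it is a multiple of \<open>\<psi>((z + Q)/P)\<close>, to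
  be expanded for \<open>P\<O>\<close>.
\<close>
theorem degeneracy_in_cusp_forms:
  assumes P: "irreducible P" and \<psi>: "\<psi> \<in> cusp_forms \<iota> GL2 k m"
  shows "degeneracy \<iota> k m P \<psi> \<in> cusp_forms \<iota> (Gamma0 P) k m"
proof -
  have prime: "prime_elem P" using P by (rule field_poly_irreducible_imp_prime)
  have P0: "P \<noteq> 0" using P by auto
  have deg: "degree P > 0" using P by (rule irreducible_poly_degree_pos)
  define p where "p = cpoly \<iota> P"
  have p: "p \<noteq> 0" using P0 by (simp add: p_def)
  from \<psi> have rigid: "rigid_analytic \<iota> \<psi>" and inv: "\<And>\<gamma>. \<gamma> \<in> GL2 \<Longrightarrow> pslash \<iota> k m \<psi> \<gamma> = \<psi>"
    by (auto simp: cusp_forms_iff)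
  have "mat2 1 0 0 1 \<in> GL2" by (simp add: GL2_iff det_mat2)
  then have cusp: "vanishes_at_infinity UNIV \<psi>"
    using \<psi> by (auto simp: cusp_forms_iff translation_lattice_GL2 dest!: bspec)
  define \<phi> where "\<phi> = degeneracy \<iota> k m P \<psi>"
  have \<phi>: "\<phi> = (\<lambda>z. p powi m * \<psi> (p * z))"
    unfolding \<phi>_def p_def by (rule degeneracy_apply[OF rigid P0])
  have \<phi>_inv: "pslash \<iota> k m \<phi> \<gamma> = \<phi>" if "\<gamma> \<in> Gamma0 P" for \<gamma>
  proof -
    obtain a b c d where \<gamma>: "\<gamma> = mat2 a b c d" by (rule mat2_cases)
    obtain c' where c': "c = P * c'" and unit: "a * d - b * c dvd 1"
      using \<open>\<gamma> \<in> Gamma0 P\<close> by (auto simp: \<gamma> Gamma0_mat2)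
    have "pslash \<iota> k m \<phi> \<gamma> = pslash \<iota> k m \<psi> (mat2 P 0 0 1 ** \<gamma>)"
      unfolding \<phi>_def degeneracy_def using unit P0
      by (intro pslash_pslash) (auto simp: \<gamma> det_mat2)
    also have "mat2 P 0 0 1 ** \<gamma> = mat2 a (P * b) c' d ** mat2 P 0 0 1"
      by (simp add: \<gamma> mat2_mult mat2_eq_iff c' mult.commute)
    also have "pslash \<iota> k m \<psi> \<dots> = pslash \<iota> k m (pslash \<iota> k m \<psi> (mat2 a (P * b) c' d)) (mat2 P 0 0 1)"
      using unit P0 by (intro pslash_pslash[symmetric]) (auto simp: det_mat2 c' mult_ac)
    also have "pslash \<iota> k m \<psi> (mat2 a (P * b) c' d) = \<psi>"
      using unit by (intro inv) (simp add: GL2_iff det_mat2 c' mult_ac)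
    finally show ?thesis by (simp add: \<phi>_def degeneracy_def)
  qed
  have "vanishes_at_infinity (translation_lattice (Gamma0 P) \<gamma>) (pslash \<iota> k m \<phi> \<gamma>)"
    if \<gamma>: "\<gamma> \<in> GL2" for \<gamma>
  proof -
    obtain a b c d where \<gamma>m: "\<gamma> = mat2 a b c d" by (rule mat2_cases)
    have lattice: "translation_lattice (Gamma0 P) \<gamma> = {\<beta>. P dvd c ^ 2 * \<beta>}"
      using \<gamma> unfolding \<gamma>m by (rule translation_lattice_Gamma0)
    show ?thesis
    proof (cases "P dvd c")
      case True
      then have "\<gamma> \<in> Gamma0 P" using \<gamma> by (simp add: \<gamma>m Gamma0_mat2 GL2_iff det_mat2)
      moreover have "{\<beta>. P dvd c ^ 2 * \<beta>} = UNIV" using True by (simp add: power2_eq_square)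
      moreover have "vanishes_at_infinity UNIV \<phi>"
        by (rule vanishes_at_infinity_cmult[OF vanishes_at_infinity_scale[OF cusp deg], where c = "p powi m"])
           (simp add: \<phi> p_def)
      ultimately show ?thesis by (simp add: lattice \<phi>_inv)
    next
      case False
      then obtain g Q where g: "g \<in> Gamma0 P" "\<gamma> = g ** mat2 0 (- 1) 1 Q"
        using Gamma0_coset_decomposition[OF P] \<gamma> unfolding \<gamma>m by metis
      have "pslash \<iota> k m \<phi> \<gamma> = pslash \<iota> k m (pslash \<iota> k m \<phi> g) (mat2 0 (- 1) 1 Q)"
        unfolding g(2) using g(1) Gamma0_subset_GL2[of P]
        by (intro pslash_pslash[symmetric]) (auto simp: det_GL2_nonzero subset_iff det_mat2)
      also have "\<dots> = pslash \<iota> k m \<phi> (mat2 0 (- 1) 1 Q)" by (simp only: \<phi>_inv[OF g(1)])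
      also have "\<dots> = pslash \<iota> k m \<psi> (mat2 P 0 0 1 ** mat2 0 (- 1) 1 Q)"
        unfolding \<phi>_def degeneracy_def using P0
        by (intro pslash_pslash) (auto simp: det_mat2)
      also have "mat2 P 0 0 1 ** mat2 0 (- 1) 1 Q = mat2 0 (- 1) 1 0 ** mat2 1 Q 0 P"
        by (simp add: mat2_mult mat2_eq_iff)
      also have "pslash \<iota> k m \<psi> \<dots> = pslash \<iota> k m (pslash \<iota> k m \<psi> (mat2 0 (- 1) 1 0)) (mat2 1 Q 0 P)"
        using P0 by (intro pslash_pslash[symmetric]) (auto simp: det_mat2)
      also have "pslash \<iota> k m \<psi> (mat2 0 (- 1) 1 0) = \<psi>"
        by (rule inv) (simp add: GL2_iff det_mat2)
      finally have "pslash \<iota> k m \<phi> \<gamma> = pslash \<iota> k m \<psi> (mat2 1 Q 0 P)" .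
      moreover have "{\<beta>. P dvd c ^ 2 * \<beta>} = {\<beta>. P dvd \<beta>}"
        using False prime by (auto simp: prime_elem_dvd_mult_iff power2_eq_square)
      moreover have "vanishes_at_infinity {\<beta>. P dvd \<beta>} (pslash \<iota> k m \<psi> (mat2 1 Q 0 P))"
        by (rule vanishes_at_infinity_cmult[OF vanishes_at_infinity_affine[OF cusp P0, of Q],
              where c = "p powi m * p powi (- k)"])
           (simp add: pslash_mat2 hom_one p_def)
      ultimately show ?thesis by (simp add: lattice)
    qed
  qed
  moreover have "rigid_analytic \<iota> \<phi>"
    unfolding \<phi> p_def using P0 by (intro rigid_analytic_scale[OF rigid]) simp
  ultimately show ?thesis
    unfolding \<phi>_def[symmetric] using \<phi>_inv by (auto simp: cusp_forms_iff)
qed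

text \<open>All \<open>q\<^sup>d\<close> terms of the sum coincide, where \<open>d = deg P\<close>, and \<open>q = 0\<close> in \<open>\<C>\<^sub>\<infinity>\<close>.\<close>
theorem Atkin_U_degeneracy:
  assumes P: "degree P > 0" and inv: "\<And>\<gamma>. \<gamma> \<in> GL2 \<Longrightarrow> pslash \<iota> k m \<psi> \<gamma> = \<psi>"
  shows "Atkin_U \<iota> k m P (degeneracy \<iota> k m P \<psi>) = (\<lambda>z. 0)"
proof -
  have P0: "P \<noteq> 0" using P by auto
  have "pslash \<iota> k m (degeneracy \<iota> k m P \<psi>) (mat2 1 Q 0 P) = pslash \<iota> k m \<psi> (mat2 P 0 0 P)" for Q
  proof -
    have "pslash \<iota> k m (degeneracy \<iota> k m P \<psi>) (mat2 1 Q 0 P) = pslash \<iota> k m \<psi> (mat2 P 0 0 1 ** mat2 1 Q 0 P)"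
      unfolding degeneracy_def using P0 by (intro pslash_pslash) (auto simp: det_mat2)
    also have "mat2 P 0 0 1 ** mat2 1 Q 0 P = mat2 1 Q 0 1 ** mat2 P 0 0 P"
      by (simp add: mat2_mult mat2_eq_iff mult.commute)
    also have "pslash \<iota> k m \<psi> \<dots> = pslash \<iota> k m (pslash \<iota> k m \<psi> (mat2 1 Q 0 1)) (mat2 P 0 0 P)"
      using P0 by (intro pslash_pslash[symmetric]) (auto simp: det_mat2)
    also have "pslash \<iota> k m \<psi> (mat2 1 Q 0 1) = \<psi>"
      by (rule inv) (simp add: GL2_iff det_mat2)
    finally show ?thesis .
  qed
  then show ?thesis
    unfolding Atkin_U_def residues_eq_deg_le[OF P] by (simp add: of_nat_card_deg_le)
qed

text \<open>
  The form \<open>\<theta> = \<phi>|W\<close> is invariant under \<open>\<Gamma>\<^sub>0(P)\<close> because \<open>W\<close> normalises this group, and \<open>U \<phi> = 0\<close> makes it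
  invariant under \<open>GL\<^sub>2(\<O>)\<close>. Two descriptions of \<open>\<theta>\<close> serve for its analytic properties. From
  \<open>\<theta> = \<theta>|S = \<phi>|(1, 0; 0, P)\<close>, a multiple of \<open>\<phi>(z/P)\<close>, one reads off that it is rigid analytic. From
  \<open>W = S\<^sup>-\<^sup>1 A\<close> one sees that it is a multiple of \<open>(\<phi>|S\<^sup>-\<^sup>1)(P z)\<close>, where \<open>\<phi>|S\<^sup>-\<^sup>1\<close> has an expansion for
  the lattice \<open>P\<O>\<close>; this gives one for \<open>\<O>\<close>, which is the lattice of \<open>GL\<^sub>2(\<O>)\<close> at every cusp.
\<close>
theorem Atkin_U_kernel_is_old:
  assumes P: "irreducible P" and \<phi>: "\<phi> \<in> cusp_forms \<iota> (Gamma0 P) k m"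
    and U: "Atkin_U \<iota> k m P \<phi> = (\<lambda>z. 0)"
  obtains \<psi> where "\<psi> \<in> cusp_forms \<iota> GL2 k m" "\<phi> = degeneracy \<iota> k m P \<psi>"
proof -
  have P0: "P \<noteq> 0" using P by auto
  define p where "p = cpoly \<iota> P"
  have p: "p \<noteq> 0" using P0 by (simp add: p_def)
  from \<phi> have rigid: "rigid_analytic \<iota> \<phi>" and inv: "\<And>\<gamma>. \<gamma> \<in> Gamma0 P \<Longrightarrow> pslash \<iota> k m \<phi> \<gamma> = \<phi>"
    and cusp: "\<And>\<gamma>. \<gamma> \<in> GL2 \<Longrightarrow>
      vanishes_at_infinity (translation_lattice (Gamma0 P) \<gamma>) (pslash \<iota> k m \<phi> \<gamma>)"
    by (auto simp: cusp_forms_iff)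
  let ?W = "mat2 0 1 (- P) 0"
  define \<theta> where "\<theta> = pslash \<iota> k m \<phi> ?W"
  have W_det: "det ?W \<noteq> 0" using P0 by (simp add: det_mat2)
  have \<theta>_Gamma0: "pslash \<iota> k m \<theta> \<gamma> = \<theta>" if "\<gamma> \<in> Gamma0 P" for \<gamma>
  proof -
    obtain a b c d where \<gamma>: "\<gamma> = mat2 a b c d" by (rule mat2_cases)
    obtain c' where c': "c = P * c'" and unit: "a * d - b * c dvd 1"
      using \<open>\<gamma> \<in> Gamma0 P\<close> by (auto simp: \<gamma> Gamma0_mat2)
    have "pslash \<iota> k m \<theta> \<gamma> = pslash \<iota> k m \<phi> (?W ** \<gamma>)"
      unfolding \<theta>_def using unit W_det by (intro pslash_pslash) (auto simp: \<gamma> det_mat2)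
    also have "?W ** \<gamma> = mat2 d (- c') (- P * b) a ** ?W"
      by (simp add: \<gamma> mat2_mult mat2_eq_iff c' mult.commute)
    also have "pslash \<iota> k m \<phi> \<dots> = pslash \<iota> k m (pslash \<iota> k m \<phi> (mat2 d (- c') (- P * b) a)) ?W"
      using unit W_det by (intro pslash_pslash[symmetric]) (auto simp: det_mat2 c' mult_ac)
    also have "pslash \<iota> k m \<phi> (mat2 d (- c') (- P * b) a) = \<phi>"
      using unit by (intro inv) (simp add: Gamma0_mat2 c' mult_ac)
    finally show ?thesis by (simp add: \<theta>_def)
  qed
  have sum: "(\<Sum>Q | degree Q < degree P. pslash \<iota> k m \<theta> (mat2 0 (- 1) 1 Q) z) = 0" for z
  proof -
    have "pslash \<iota> k m \<theta> (mat2 0 (- 1) 1 Q) = pslash \<iota> k m \<phi> (mat2 1 Q 0 P)" for Q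
      unfolding \<theta>_def using W_det by (subst pslash_pslash) (simp_all add: det_mat2 mat2_mult)
    moreover have "p powi (k - m) * (\<Sum>Q | degree Q < degree P. pslash \<iota> k m \<phi> (mat2 1 Q 0 P) z) = 0"
      using fun_cong[OF U, of z] by (simp add: Atkin_U_def p_def)
    ultimately show ?thesis using p by simp
  qed
  have \<theta>_GL2: "pslash \<iota> k m \<theta> \<gamma> = \<theta>" if "\<gamma> \<in> GL2" for \<gamma>
    by (rule GL2_invariant_if_trace_vanishes[OF P \<theta>_Gamma0 sum that])
  have \<theta>_B: "\<theta> = pslash \<iota> k m \<phi> (mat2 1 0 0 P)"
  proof -
    have "\<theta> = pslash \<iota> k m \<theta> (mat2 0 (- 1) 1 0)"
      by (rule \<theta>_GL2[symmetric]) (simp add: GL2_iff det_mat2)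
    also have "\<dots> = pslash \<iota> k m \<phi> (mat2 1 0 0 P)"
      unfolding \<theta>_def using W_det by (subst pslash_pslash) (simp_all add: det_mat2 mat2_mult)
    finally show ?thesis .
  qed
  \<comment> \<open>The scalar matrix \<open>(P, 0; 0, P)\<close> acts as multiplication by \<open>P\<^sup>2\<^sup>m\<^sup>-\<^sup>k\<close>.\<close>
  define c where "c = p powi (k - 2 * m)"
  define \<psi> where "\<psi> = (\<lambda>z. c * \<theta> z)"
  have \<psi>_inv: "pslash \<iota> k m \<psi> \<gamma> = \<psi>" if "\<gamma> \<in> GL2" for \<gamma>
    unfolding \<psi>_def slash_cmult \<theta>_GL2[OF that] ..
  have \<psi>_scale: "\<psi> = (\<lambda>z. c * p powi m * p powi (- k) * \<phi> (\<iota> (inverse (poly_fls P)) * z))"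
  proof
    fix z
    have "\<phi> (\<iota> (inverse (poly_fls P)) * z) = 0" if "z \<notin> Omega \<iota>"
      using that rigid P0 scale_Omega[of "inverse (poly_fls P)" z] by (simp add: rigid_analytic_def)
    then show "\<psi> z = c * p powi m * p powi (- k) * \<phi> (\<iota> (inverse (poly_fls P)) * z)"
      unfolding \<psi>_def \<theta>_B pslash_mat2
      by (auto simp: hom_one p_def iota_inverse divide_inverse mult_ac)
  qed
  have "vanishes_at_infinity UNIV \<psi>"
  proof -
    \<comment> \<open>The inverse of \<open>S\<close>.\<close>
    let ?S' = "mat2 0 1 (- 1) 0 :: 'a poly^2^2"
    have S: "?S' \<in> GL2" by (simp add: GL2_iff det_mat2)
    have "\<theta> = pslash \<iota> k m (pslash \<iota> k m \<phi> ?S') (mat2 P 0 0 1)"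
      unfolding \<theta>_def using P0 by (subst pslash_pslash) (simp_all add: det_mat2 mat2_mult)
    then have "\<psi> z = c * p powi m * pslash \<iota> k m \<phi> ?S' (p * z)" if "z \<in> Omega \<iota>" for z
      using that by (simp add: \<psi>_def pslash_mat2[of k m _ P] hom_one p_def)
    moreover have "vanishes_at_infinity {l. P dvd l} (pslash \<iota> k m \<phi> ?S')"
      using cusp[OF S] translation_lattice_Gamma0[OF S] by simp
    ultimately show ?thesis
      using vanishes_at_infinity_cmult[OF vanishes_at_infinity_scale_multiples[OF _ P0]]
      unfolding p_def by blast
  qed
  then have "\<psi> \<in> cusp_forms \<iota> GL2 k m"
    using \<psi>_inv P0 unfolding cusp_forms_iff
    by (auto simp: translation_lattice_GL2 \<psi>_scale intro!: rigid_analytic_scale[OF rigid])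
  moreover have "\<phi> = degeneracy \<iota> k m P \<psi>"
  proof
    fix z
    have "pslash \<iota> k m \<theta> (mat2 P 0 0 1) = pslash \<iota> k m \<phi> (mat2 P 0 0 P)"
      unfolding \<theta>_B using P0 by (subst pslash_pslash) (simp_all add: det_mat2 mat2_mult)
    then have "degeneracy \<iota> k m P \<psi> z = c * pslash \<iota> k m \<phi> (mat2 P 0 0 P) z"
      by (simp add: degeneracy_def \<psi>_def slash_cmult)
    also have "\<dots> = \<phi> z"
    proof (cases "z \<in> Omega \<iota>")
      case True
      have "p powi (k - 2 * m) * ((p * p) powi m * p powi (- k)) = 1"
        using p by (simp add: power_int_mult_distrib power_int_diff power_int_minus
            power_int_mult power_int_numeral field_simps power2_eq_square)
      then show ?thesis
        using True p by (simp add: pslash_mat2 c_def p_def[symmetric] cpoly_mult mult_ac)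
    qed (use rigid in \<open>simp add: pslash_mat2 rigid_analytic_def\<close>)
    finally show "\<phi> z = degeneracy \<iota> k m P \<psi> z" ..
  qed
  ultimately show ?thesis by (rule that)
qed

end

theorem proposition2p7:
  fixes \<iota> :: "'a::{finite,field} fls \<Rightarrow> 'c::{field,complete_space}"
    and P :: "'a poly" and d :: nat and k m :: int
  assumes "C_infinity \<iota>"
    and "irreducible P" and "lead_coeff P = 1" and "degree P = d"
    and "k \<ge> 0"
  shows "{\<phi> \<in> cusp_forms \<iota> (Gamma0 P) k m. Atkin_U \<iota> k m P \<phi> = (\<lambda>z. 0)} =
         degeneracy \<iota> k m P ` cusp_forms \<iota> GL2 k m"
proof -
  interpret C_infinity \<iota> by fact
  have deg: "degree P > 0" using \<open>irreducible P\<close> by (rule irreducible_poly_degree_pos)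
  show ?thesis
  proof (intro equalityI subsetI)
    fix \<phi> assume "\<phi> \<in> {\<phi> \<in> cusp_forms \<iota> (Gamma0 P) k m. Atkin_U \<iota> k m P \<phi> = (\<lambda>z. 0)}"
    then obtain \<psi> where "\<psi> \<in> cusp_forms \<iota> GL2 k m" "\<phi> = degeneracy \<iota> k m P \<psi>"
      using Atkin_U_kernel_is_old[OF \<open>irreducible P\<close>] by blast
    then show "\<phi> \<in> degeneracy \<iota> k m P ` cusp_forms \<iota> GL2 k m" by blast
  next
    fix \<phi> assume "\<phi> \<in> degeneracy \<iota> k m P ` cusp_forms \<iota> GL2 k m"
    then obtain \<psi> where \<psi>: "\<psi> \<in> cusp_forms \<iota> GL2 k m" "\<phi> = degeneracy \<iota> k m P \<psi>" by blast
    then have "Atkin_U \<iota> k m P \<phi> = (\<lambda>z. 0)"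
      using Atkin_U_degeneracy[OF deg] by (simp add: cusp_forms_iff)
    then show "\<phi> \<in> {\<phi> \<in> cusp_forms \<iota> (Gamma0 P) k m. Atkin_U \<iota> k m P \<phi> = (\<lambda>z. 0)}"
      using degeneracy_in_cusp_forms[OF \<open>irreducible P\<close> \<psi>(1)] \<psi>(2) by simp
  qed
qed

end
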